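(* Let $J_\sigma$ be the shape functional $$J_\sigma(\Omega'):=\max\Big\{\max_{x\in\overline{\Omega'\setminus\omega}}\sigma_M^2(u_{\Omega'})(x)-\delta,\;0\Big\},$$ and let $X\in C^1(\overline{\mathsf D})^d$ with $\operatorname{supp}(X)\subset\mathsf D\setminus\overline\omega$. Write $u:=u_\Omega$, let $\dot u$ be the material derivative in direction $X$ (defined in the context), and put $$A(u):=\{z\in K\mid \sigma_M^2(u)(z)=\max_{x\in K}\sigma_M^2(u)(x)\},$$ $$f_X(x):=2B\varepsilon(u)(x):\varepsilon(\dot u)(x)-B[\partial u\,\partial X+(\partial X)^\top(\partial u)^\top](x):\varepsilon(u)(x).$$ Then the shape derivative $DJ_\sigma(\Omega)(X):=\lim_{t\searrow0}\frac{J_\sigma(\Omega_t)-J_\sigma(\Omega)}{t}$ exists and $$DJ_\sigma(\Omega)(X)=\begin{cases}\max_{x\in A(u)}f_X(x), & \text{if }\sigma_M^2(u)|_{A(u)}>\delta,\\ \max\{\max_{x\in A(u)}f_X(x),\,0\}, & \text{if }\sigma_M^2(u)|_{A(u)}=\delta,\\ 0, & \text{if }\sigma_M^2(u)|_{A(u)}<\delta.\end{cases}$$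
   Context: Setting. $\mathsf D\subset\mathbb R^d$ is a bounded Lipschitz domain, $\Gamma\subset\mathsf D$ a smooth Lipschitz manifold, $\Omega\subset\mathsf D$ a Lipschitz set with $\Gamma\subset\partial\Omega$, $\Gamma^N:=\partial\Omega\setminus\Gamma$, $\omega\subset\mathsf D$ is open with $\Gamma\subset\omega$, and $K:=\overline{\Omega\setminus\omega}$. $n$ is the normal vector on $\Gamma^N$; $f\in H^1(\mathsf D)^d$, $g\in H^2(\mathsf D)^d$, $\delta>0$, Lamé coefficients $\lambda,\mu>0$. $\partial v$ is the Jacobian, $\varepsilon(v):=\frac12(\partial v+\partial v^\top)$, $A(M):=2\mu M+\lambda\operatorname{tr}(M)I_d$, $B(M):=6\mu M+(\lambda-2\mu)\operatorname{tr}(M)I_d$ for $M\in\mathbb R^{d\times d}$, $M:N$ is the Frobenius product, and $\sigma_M^2(v):=B\varepsilon(v):\varepsilon(v)$ (squared von Mises stress). (The tensor $A$ and the set $A(u)$ are unrelated.) $H^1_\Gamma(\Omega)^d:=\{v\in H^1(\Omega)^d\mid v|_\Gamma=0\}$. State. For a Lipschitz set $\Omega'\subset\mathsf D$ with $\Gamma\subset\partial\Omega'$, $u_{\Omega'}\in H^1_\Gamma(\Omega')^d$ is the unique solution (unique solvability is understood) of $\int_{\Omega'}A\varepsilon(u_{\Omega'}):\varepsilon(\varphi)\,dx=\int_{\Omega'}f\cdot\varphi\,dx+\int_{\partial\Omega'\setminus\Gamma}g\cdot\varphi\,dS$ for all $\varphi\in H^1_\Gamma(\Omega')^d$. Perturbations.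 For $X,Y\in C^1(\overline{\mathsf D})^d$ with supports in $\mathsf D\setminus\overline\omega$, $\|Y\|_{C^1(\overline{\mathsf D})^d}$ and $t\ge0$ sufficiently small, $F_{Y,t}:=\mathrm{Id}+Y+tX$, $u^{Y,t}:=u_{F_{Y,t}(\Omega)}\circ F_{Y,t}\in H^1_\Gamma(\Omega)^d$, $u^Y:=u^{Y,0}$, $u:=u^0=u_\Omega$. $F_t:=F_{0,t}=\mathrm{Id}+tX$, $\Omega_t:=F_t(\Omega)$. Limits $Y\to0$ are in $C^1(\overline{\mathsf D})^d$. Material derivative. $\dot u\in H^1_\Gamma(\Omega)^d$ is the unique solution of, for all $\varphi\in H^1_\Gamma(\Omega)^d$, $$\begin{aligned}\int_\Omega A\varepsilon(\dot u):\varepsilon(\varphi)\,dx=&\tfrac12\int_\Omega A[\partial u\,\partial X+\partial X^\top\partial u^\top]:\varepsilon(\varphi)\,dx-\int_\Omega\operatorname{div}X\,A\varepsilon(u):\varepsilon(\varphi)\,dx\\&+\tfrac12\int_\Omega A\varepsilon(u):[\partial\varphi\,\partial X+\partial X^\top\partial\varphi^\top]\,dx+\int_\Omega\operatorname{div}X\,f\cdot\varphi\,dx+\int_\Omega\partial f\,X\cdot\varphi\,dx\\&+\int_{\Gamma^N}(\operatorname{div}X-(\partial X\,n)\cdot n)\,g\cdot\varphi\,dS+\int_{\Gamma^N}\partial g\,X\cdot\varphi\,dS.\end{aligned}$$ Standing regularity assumption. For every such $X$: $u^{Y,t}\in C^1(K)^d$ for $\|Y\|_{C^1(\overline{\mathsf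 D})^d}$, $t\ge 0$ small, $\lim_{Y\to0,\,t\searrow0}\|u^{Y,t}-u\|_{C^1(K)^d}=0$ and $\lim_{Y\to0,\,t\searrow0}\|\frac{u^{Y,t}-u^Y}{t}-\dot u\|_{C^1(K)^d}=0$. Pointwise values of gradients on $K$ and on $F_t(K)=\overline{\Omega_t\setminus\omega}$ are those of these $C^1$ representatives. *)

theory Defs
  imports "HOL-Analysis.Analysis"
begin

section \<open>Smooth functions, Lipschitz sets and hypersurfaces\<close>

definition partial :: "'n \<Rightarrow> (real^'n \<Rightarrow> 'b::real_normed_vector) \<Rightarrow> real^'n::finite \<Rightarrow> 'b" where
  "partial i v x = frechet_derivative v (at x) (axis i 1)"

primrec Ck_on :: "nat \<Rightarrow> (real^'n::finite) set \<Rightarrow> (real^'n \<Rightarrow> 'b::real_normed_vector) \<Rightarrow> bool" where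
  "Ck_on 0 U v = continuous_on U v"
| "Ck_on (Suc k) U v = ((\<forall>x\<in>U. v differentiable (at x)) \<and> (\<forall>i. Ck_on k U (partial i v)))"

definition smooth_on :: "(real^'n::finite) set \<Rightarrow> (real^'n \<Rightarrow> 'b::real_normed_vector) \<Rightarrow> bool" where
  "smooth_on U v \<longleftrightarrow> (\<forall>k. Ck_on k U v)"

definition lipschitz_height :: "real^'n::finite \<Rightarrow> (real^'n \<Rightarrow> real) \<Rightarrow> bool" where
  \<comment> \<open>a Lipschitz function on the hyperplane orthogonal to the unit vector \<open>\<nu>\<close>,
      extended to the whole space so as to be constant in the direction \<open>\<nu>\<close>\<close>
  "lipschitz_height \<nu> \<gamma> \<longleftrightarrow>
     norm \<nu> = 1 \<and> (\<exists>L. L-lipschitz_on UNIV \<gamma>) \<and> (\<forall>y s. \<gamma> (y + s *\<^sub>R \<nu>) = \<gamma> y)"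

definition lipschitz_set :: "(real^'n::finite) set \<Rightarrow> bool" where
  \<comment> \<open>open sets lying locally on one side of a boundary which is locally a Lipschitz graph\<close>
  "lipschitz_set S \<longleftrightarrow> open S \<and>
     (\<forall>p\<in>frontier S. \<exists>\<nu> \<gamma> r. lipschitz_height \<nu> \<gamma> \<and> r > 0 \<and>
        (\<forall>y\<in>ball p r. y \<in> S \<longleftrightarrow> y \<bullet> \<nu> < \<gamma> y))"

definition smooth_lipschitz_hypersurface :: "(real^'n::finite) set \<Rightarrow> bool" where
  \<comment> \<open>smooth embedded submanifolds of codimension one with a (possibly empty) Lipschitz boundary\<close>
  "smooth_lipschitz_hypersurface M \<longleftrightarrow>
     (\<forall>p\<in>M. \<exists>U V \<Phi> \<Psi> e. open U \<and> p \<in> U \<and> open V \<and> homeomorphism U V \<Phi> \<Psi> \<and>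
        smooth_on U \<Phi> \<and> smooth_on V \<Psi> \<and> norm (e :: real^'n) = 1 \<and>
        (\<Phi> ` (M \<inter> U) = {y\<in>V. y \<bullet> e = 0} \<or>
         (\<exists>\<nu> \<gamma>. lipschitz_height \<nu> \<gamma> \<and> \<nu> \<bullet> e = 0 \<and>
            \<Phi> ` (M \<inter> U) = {y\<in>V. y \<bullet> e = 0 \<and> y \<bullet> \<nu> \<le> \<gamma> y})))"

definition outer_normal :: "(real^'n::finite) set \<Rightarrow> real^'n \<Rightarrow> real^'n" where
  \<comment> \<open>for a Lipschitz set this exists at every boundary point at which the local graph is
      differentiable, hence almost everywhere on the boundary\<close>
  "outer_normal S x = (SOME \<nu>. norm \<nu> = 1 \<and>
     (\<forall>\<epsilon>>0. \<exists>r>0. \<forall>y\<in>ball x r.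
        ((y - x) \<bullet> \<nu> < - \<epsilon> * norm (y - x) \<longrightarrow> y \<in> S) \<and>
        ((y - x) \<bullet> \<nu> > \<epsilon> * norm (y - x) \<longrightarrow> y \<notin> S)))"


section \<open>Surface measure\<close>

definition hausdorff_content :: "nat \<Rightarrow> real \<Rightarrow> 'a::euclidean_space set \<Rightarrow> ennreal" where
  \<comment> \<open>boundedness is required because the library's \<^const>\<open>diameter\<close> is unspecified on unbounded
      sets; empty sets are treated separately because of \<open>0 ^ 0 = 1\<close>\<close>
  "hausdorff_content s r A =
     (INF C\<in>{C :: nat \<Rightarrow> 'a set. A \<subseteq> (\<Union>i. C i) \<and> (\<forall>i. bounded (C i) \<and> diameter (C i) \<le> r)}.
        \<Sum>i. if C i = {} then 0 else ennreal (unit_ball_vol (real s) * (diameter (C i) / 2) ^ s))"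

definition hausdorff_outer :: "nat \<Rightarrow> 'a::euclidean_space set \<Rightarrow> ennreal" where
  "hausdorff_outer s A = (SUP r\<in>{0<..}. hausdorff_content s r A)"

definition surface_measure :: "(real^'n::finite) measure" where
  "surface_measure = measure_of UNIV (sets borel) (hausdorff_outer (CARD('n) - 1))"


section \<open>Sobolev spaces and traces\<close>

text \<open>
  Elements of the Sobolev spaces on \<open>S\<close> are represented by total functions, whose values outside
  \<open>S\<close> are irrelevant; they are identified if they agree almost everywhere on \<open>S\<close>.
\<close>

definition L2_on :: "(real^'n::finite) set \<Rightarrow> (real^'n \<Rightarrow> 'b::euclidean_space) \<Rightarrow> bool" where
  "L2_on S v \<longleftrightarrow> v \<in> borel_measurable (lebesgue_on S) \<and>
     integrable (lebesgue_on S) (\<lambda>x. (norm (v x))\<^sup>2)"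

definition test_function :: "(real^'n::finite) set \<Rightarrow> (real^'n \<Rightarrow> real) \<Rightarrow> bool" where
  "test_function S \<phi> \<longleftrightarrow> smooth_on UNIV \<phi> \<and>
     compact (closure {x. \<phi> x \<noteq> 0}) \<and> closure {x. \<phi> x \<noteq> 0} \<subseteq> S"

definition is_weak_partial ::
  "(real^'n::finite) set \<Rightarrow> 'n \<Rightarrow> (real^'n \<Rightarrow> 'b::euclidean_space) \<Rightarrow> (real^'n \<Rightarrow> 'b) \<Rightarrow> bool" where
  "is_weak_partial S i v w \<longleftrightarrow> (\<forall>\<phi>. test_function S \<phi> \<longrightarrow>
     (LINT x|lebesgue_on S. partial i \<phi> x *\<^sub>R v x) = - (LINT x|lebesgue_on S. \<phi> x *\<^sub>R w x))"

definition H1 :: "(real^'n::finite) set \<Rightarrow> (real^'n \<Rightarrow> 'b::euclidean_space) \<Rightarrow> bool" where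
  "H1 S v \<longleftrightarrow> L2_on S v \<and> (\<forall>i. \<exists>w. L2_on S w \<and> is_weak_partial S i v w)"

definition weak_partial ::
  "(real^'n::finite) set \<Rightarrow> 'n \<Rightarrow> (real^'n \<Rightarrow> 'b::euclidean_space) \<Rightarrow> real^'n \<Rightarrow> 'b" where
  "weak_partial S i v = (SOME w. L2_on S w \<and> is_weak_partial S i v w)"

definition H2 :: "(real^'n::finite) set \<Rightarrow> (real^'n \<Rightarrow> 'b::euclidean_space) \<Rightarrow> bool" where
  "H2 S v \<longleftrightarrow> H1 S v \<and> (\<forall>i. H1 S (weak_partial S i v))"

definition weak_jacobian ::
  "(real^'n::finite) set \<Rightarrow> (real^'n \<Rightarrow> real^'n) \<Rightarrow> real^'n \<Rightarrow> real^'n^'n" where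
  "weak_jacobian S v x = (\<chi> i j. weak_partial S j v x $ i)"

definition is_trace ::
  "(real^'n::finite) set \<Rightarrow> (real^'n \<Rightarrow> 'b::euclidean_space) \<Rightarrow> (real^'n \<Rightarrow> 'b) \<Rightarrow> bool" where
  \<comment> \<open>the continuous extension to \<open>H\<^sup>1\<close> of the restriction of smooth functions to the boundary\<close>
  "is_trace S v T \<longleftrightarrow> T \<in> borel_measurable borel \<and>
     (\<exists>\<phi> :: nat \<Rightarrow> real^'n \<Rightarrow> 'b. (\<forall>k. smooth_on UNIV (\<phi> k)) \<and>
        (\<lambda>k. \<integral>\<^sup>+x. ennreal ((norm (\<phi> k x - v x))\<^sup>2) \<partial>lebesgue_on S) \<longlonglongrightarrow> 0 \<and>
        (\<forall>i. (\<lambda>k. \<integral>\<^sup>+x. ennreal ((norm (partial i (\<phi> k) x - weak_partial S i v x))\<^sup>2)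
                \<partial>lebesgue_on S) \<longlonglongrightarrow> 0) \<and>
        (\<lambda>k. \<integral>\<^sup>+x\<in>frontier S. ennreal ((norm (\<phi> k x - T x))\<^sup>2) \<partial>surface_measure) \<longlonglongrightarrow> 0)"

definition bd_trace ::
  "(real^'n::finite) set \<Rightarrow> (real^'n \<Rightarrow> 'b::euclidean_space) \<Rightarrow> real^'n \<Rightarrow> 'b" where
  "bd_trace S v = (SOME T. is_trace S v T)"

definition H1_zero ::
  "(real^'n::finite) set \<Rightarrow> (real^'n) set \<Rightarrow> (real^'n \<Rightarrow> real^'n) set" where
  "H1_zero \<Gamma> S = {v. H1 S v \<and> (AE x in surface_measure. x \<in> \<Gamma> \<longrightarrow> bd_trace S v x = 0)}"


section \<open>Linear elasticity\<close>

text \<open>The Frobenius product \<open>M : N\<close> is the inner product \<open>M \<bullet> N\<close> of \<^typ>\<open>real^'n^'n\<close>.\<close>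

definition sym_part :: "real^'n^'n \<Rightarrow> real^'n::finite^'n" where
  "sym_part M = (1/2) *\<^sub>R (M + transpose M)"

definition tensor_A :: "real \<Rightarrow> real \<Rightarrow> real^'n^'n \<Rightarrow> real^'n::finite^'n" where
  "tensor_A lam mu M = (2 * mu) *\<^sub>R M + (lam * trace M) *\<^sub>R mat 1"

definition tensor_B :: "real \<Rightarrow> real \<Rightarrow> real^'n^'n \<Rightarrow> real^'n::finite^'n" where
  "tensor_B lam mu M = (6 * mu) *\<^sub>R M + ((lam - 2 * mu) * trace M) *\<^sub>R mat 1"

definition von_mises_sq :: "real \<Rightarrow> real \<Rightarrow> real^'n^'n \<Rightarrow> real" where
  \<comment> \<open>the squared von Mises stress of \<open>v\<close> at a point, as a function of the Jacobian of \<open>v\<close> there\<close>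
  "von_mises_sq lam mu (M :: real^'n::finite^'n) = tensor_B lam mu (sym_part M) \<bullet> sym_part M"

definition is_state ::
  "real \<Rightarrow> real \<Rightarrow> (real^'n::finite \<Rightarrow> real^'n) \<Rightarrow> (real^'n \<Rightarrow> real^'n) \<Rightarrow> (real^'n) set \<Rightarrow>
   (real^'n) set \<Rightarrow> (real^'n \<Rightarrow> real^'n) \<Rightarrow> bool" where
  "is_state lam mu f g \<Gamma> S v \<longleftrightarrow> v \<in> H1_zero \<Gamma> S \<and> (\<forall>\<phi>\<in>H1_zero \<Gamma> S.
     (LINT x|lebesgue_on S.
        tensor_A lam mu (sym_part (weak_jacobian S v x)) \<bullet> sym_part (weak_jacobian S \<phi> x)) =
     (LINT x|lebesgue_on S. f x \<bullet> \<phi> x) +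
     (LINT x:frontier S - \<Gamma>|surface_measure. bd_trace S g x \<bullet> bd_trace S \<phi> x))"

definition state ::
  "real \<Rightarrow> real \<Rightarrow> (real^'n::finite \<Rightarrow> real^'n) \<Rightarrow> (real^'n \<Rightarrow> real^'n) \<Rightarrow> (real^'n) set \<Rightarrow>
   (real^'n) set \<Rightarrow> real^'n \<Rightarrow> real^'n" where
  "state lam mu f g \<Gamma> S = (SOME v. is_state lam mu f g \<Gamma> S v)"

abbreviation jac :: "(real^'n \<Rightarrow> real^'n) \<Rightarrow> real^'n::finite \<Rightarrow> real^'n^'n" where
  "jac X x \<equiv> jacobian X (at x)"

abbreviation divergence :: "(real^'n \<Rightarrow> real^'n) \<Rightarrow> real^'n::finite \<Rightarrow> real" where
  "divergence X x \<equiv> trace (jac X x)"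

definition is_material_derivative ::
  "real \<Rightarrow> real \<Rightarrow> (real^'n::finite) set \<Rightarrow> (real^'n \<Rightarrow> real^'n) \<Rightarrow> (real^'n \<Rightarrow> real^'n) \<Rightarrow>
   (real^'n) set \<Rightarrow> (real^'n) set \<Rightarrow> (real^'n \<Rightarrow> real^'n) \<Rightarrow> (real^'n \<Rightarrow> real^'n) \<Rightarrow> bool" where
  "is_material_derivative lam mu D f g \<Gamma> \<Omega> X w \<longleftrightarrow> w \<in> H1_zero \<Gamma> \<Omega> \<and>
    (let u = state lam mu f g \<Gamma> \<Omega>; du = weak_jacobian \<Omega> u; n = outer_normal \<Omega> in
     \<forall>\<phi>\<in>H1_zero \<Gamma> \<Omega>. let dphi = weak_jacobian \<Omega> \<phi> in
      (LINT x|lebesgue_on \<Omega>.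
         tensor_A lam mu (sym_part (weak_jacobian \<Omega> w x)) \<bullet> sym_part (dphi x)) =
      1/2 * (LINT x|lebesgue_on \<Omega>.
         tensor_A lam mu (du x ** jac X x + transpose (jac X x) ** transpose (du x))
           \<bullet> sym_part (dphi x))
      - (LINT x|lebesgue_on \<Omega>.
         divergence X x * (tensor_A lam mu (sym_part (du x)) \<bullet> sym_part (dphi x)))
      + 1/2 * (LINT x|lebesgue_on \<Omega>.
         tensor_A lam mu (sym_part (du x))
           \<bullet> (dphi x ** jac X x + transpose (jac X x) ** transpose (dphi x)))
      + (LINT x|lebesgue_on \<Omega>. divergence X x * (f x \<bullet> \<phi> x))
      + (LINT x|lebesgue_on \<Omega>. (weak_jacobian D f x *v X x) \<bullet> \<phi> x)
      + (LINT x:frontier \<Omega> - \<Gamma>|surface_measure.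
           (divergence X x - (jac X x *v n x) \<bullet> n x) * (bd_trace \<Omega> g x \<bullet> bd_trace \<Omega> \<phi> x))
      + (LINT x:frontier \<Omega> - \<Gamma>|surface_measure.
           (bd_trace \<Omega> (weak_jacobian D g) x *v X x) \<bullet> bd_trace \<Omega> \<phi> x))"

definition material_derivative ::
  "real \<Rightarrow> real \<Rightarrow> (real^'n::finite) set \<Rightarrow> (real^'n \<Rightarrow> real^'n) \<Rightarrow> (real^'n \<Rightarrow> real^'n) \<Rightarrow>
   (real^'n) set \<Rightarrow> (real^'n) set \<Rightarrow> (real^'n \<Rightarrow> real^'n) \<Rightarrow> real^'n \<Rightarrow> real^'n" where
  "material_derivative lam mu D f g \<Gamma> \<Omega> X =
     (SOME w. is_material_derivative lam mu D f g \<Gamma> \<Omega> X w)"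

definition unique_ae_on ::
  "(real^'n::finite) set \<Rightarrow> ((real^'n \<Rightarrow> real^'n) \<Rightarrow> bool) \<Rightarrow> bool" where
  "unique_ae_on S P \<longleftrightarrow>
     (\<exists>v. P v \<and> (\<forall>w. P w \<longrightarrow> (AE x in lebesgue_on S. w x = v x)))"


section \<open>Continuously differentiable representatives\<close>

definition C1_rep ::
  "(real^'n::finite) set \<Rightarrow> (real^'n \<Rightarrow> real^'n) \<Rightarrow> (real^'n \<Rightarrow> real^'n) \<Rightarrow>
   (real^'n \<Rightarrow> real^'n^'n) \<Rightarrow> bool" where
  \<comment> \<open>\<open>V\<close> is a representative of \<open>v\<close> in \<open>C\<^sup>1(K)\<close>, where \<open>K = closure S\<close>: it is differentiable in
      the interior of \<open>K\<close>, and \<open>V\<close> and its Jacobian extend continuously to \<open>K\<close>, the latter as \<open>G\<close>.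
      If \<open>S = \<Omega> - \<omega>\<close> with open \<open>\<Omega>\<close> and \<open>\<omega>\<close>, and \<open>K\<close> is the closure of its interior, then \<open>v\<close>
      determines \<open>V\<close> and \<open>G\<close> on \<open>K\<close>.\<close>
  "C1_rep S v V G \<longleftrightarrow>
     (AE x in lebesgue_on S. V x = v x) \<and>
     continuous_on (closure S) V \<and> continuous_on (closure S) G \<and>
     (\<forall>x\<in>interior (closure S). (V has_derivative (\<lambda>h. G x *v h)) (at x))"

definition in_C1 :: "(real^'n::finite) set \<Rightarrow> (real^'n \<Rightarrow> real^'n) \<Rightarrow> bool" where
  "in_C1 S v \<longleftrightarrow> (\<exists>V G. C1_rep S v V G)"

definition C1_val :: "(real^'n::finite) set \<Rightarrow> (real^'n \<Rightarrow> real^'n) \<Rightarrow> real^'n \<Rightarrow> real^'n" where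
  "C1_val S v = (SOME V. \<exists>G. C1_rep S v V G)"

definition C1_jac :: "(real^'n::finite) set \<Rightarrow> (real^'n \<Rightarrow> real^'n) \<Rightarrow> real^'n \<Rightarrow> real^'n^'n" where
  "C1_jac S v = (SOME G. \<exists>V. C1_rep S v V G)"

definition C1_norm :: "(real^'n::finite) set \<Rightarrow> (real^'n \<Rightarrow> real^'n) \<Rightarrow> real" where
  "C1_norm S v = (SUP x\<in>closure S. norm (C1_val S v x)) + (SUP x\<in>closure S. norm (C1_jac S v x))"


section \<open>Perturbations and the shape functional\<close>

definition admissible_field ::
  "(real^'n::finite) set \<Rightarrow> (real^'n) set \<Rightarrow> (real^'n \<Rightarrow> real^'n) \<Rightarrow> bool" where
  \<comment> \<open>fields in \<open>C\<^sup>1(closure D)\<close> whose support is contained in the open set \<open>D - closure \<omega>\<close>,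
      identified with their extension by zero, which is continuously differentiable everywhere\<close>
  "admissible_field D \<omega> X \<longleftrightarrow> Ck_on 1 UNIV X \<and> closure {x. X x \<noteq> 0} \<subseteq> D - closure \<omega>"

definition fields_to_zero ::
  "(real^'n::finite) set \<Rightarrow> (real^'n) set \<Rightarrow> (real^'n \<Rightarrow> real^'n) filter" where
  "fields_to_zero D \<omega> =
     inf (filtercomap (C1_norm D) (nhds 0)) (principal {Y. admissible_field D \<omega> Y})"

definition transformation ::
  "(real^'n::finite \<Rightarrow> real^'n) \<Rightarrow> (real^'n \<Rightarrow> real^'n) \<Rightarrow> real \<Rightarrow> real^'n \<Rightarrow> real^'n" where
  "transformation Y X t x = x + Y x + t *\<^sub>R X x"

definition pullback_state ::
  "real \<Rightarrow> real \<Rightarrow> (real^'n::finite \<Rightarrow> real^'n) \<Rightarrow> (real^'n \<Rightarrow> real^'n) \<Rightarrow> (real^'n) set \<Rightarrow>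
   (real^'n) set \<Rightarrow> (real^'n \<Rightarrow> real^'n) \<Rightarrow> (real^'n \<Rightarrow> real^'n) \<Rightarrow> real \<Rightarrow>
   real^'n \<Rightarrow> real^'n" where
  "pullback_state lam mu f g \<Gamma> \<Omega> X Y t =
     state lam mu f g \<Gamma> (transformation Y X t ` \<Omega>) \<circ> transformation Y X t"

definition uniquely_solvable ::
  "real \<Rightarrow> real \<Rightarrow> (real^'n::finite) set \<Rightarrow> (real^'n) set \<Rightarrow> (real^'n \<Rightarrow> real^'n) \<Rightarrow>
   (real^'n \<Rightarrow> real^'n) \<Rightarrow> (real^'n) set \<Rightarrow> (real^'n) set \<Rightarrow> (real^'n \<Rightarrow> real^'n) \<Rightarrow> bool" where
  "uniquely_solvable lam mu D \<omega> f g \<Gamma> \<Omega> X \<longleftrightarrow>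
     (\<forall>\<^sub>F (Y, t) in fields_to_zero D \<omega> \<times>\<^sub>F inf (nhds 0) (principal {0..}).
        unique_ae_on (transformation Y X t ` \<Omega>)
          (is_state lam mu f g \<Gamma> (transformation Y X t ` \<Omega>))) \<and>
     unique_ae_on \<Omega> (is_material_derivative lam mu D f g \<Gamma> \<Omega> X)"

definition C1_regular ::
  "real \<Rightarrow> real \<Rightarrow> (real^'n::finite) set \<Rightarrow> (real^'n) set \<Rightarrow> (real^'n \<Rightarrow> real^'n) \<Rightarrow>
   (real^'n \<Rightarrow> real^'n) \<Rightarrow> (real^'n) set \<Rightarrow> (real^'n) set \<Rightarrow> (real^'n \<Rightarrow> real^'n) \<Rightarrow> bool" where
  "C1_regular lam mu D \<omega> f g \<Gamma> \<Omega> X \<longleftrightarrow>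
     (let u = state lam mu f g \<Gamma> \<Omega>;
          udot = material_derivative lam mu D f g \<Gamma> \<Omega> X;
          uYt = pullback_state lam mu f g \<Gamma> \<Omega> X in
      (\<forall>\<^sub>F (Y, t) in fields_to_zero D \<omega> \<times>\<^sub>F inf (nhds 0) (principal {0..}).
         in_C1 (\<Omega> - \<omega>) (uYt Y t)) \<and>
      in_C1 (\<Omega> - \<omega>) udot \<and>
      ((\<lambda>(Y, t). C1_norm (\<Omega> - \<omega>) (\<lambda>x. uYt Y t x - u x)) \<longlongrightarrow> 0)
         (fields_to_zero D \<omega> \<times>\<^sub>F at_right 0) \<and>
      ((\<lambda>(Y, t). C1_norm (\<Omega> - \<omega>) (\<lambda>x. (uYt Y t x - uYt Y 0 x) /\<^sub>R t - udot x)) \<longlongrightarrow> 0)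
         (fields_to_zero D \<omega> \<times>\<^sub>F at_right 0))"

definition max_over :: "('a \<Rightarrow> real) \<Rightarrow> 'a set \<Rightarrow> real" where
  "max_over h S = (GREATEST m. m \<in> h ` S)"

definition J_sigma ::
  "real \<Rightarrow> real \<Rightarrow> (real^'n::finite \<Rightarrow> real^'n) \<Rightarrow> (real^'n \<Rightarrow> real^'n) \<Rightarrow> (real^'n) set \<Rightarrow>
   (real^'n) set \<Rightarrow> real \<Rightarrow> (real^'n) set \<Rightarrow> real" where
  "J_sigma lam mu f g \<Gamma> \<omega> \<delta> S =
     max (max_over (\<lambda>x. von_mises_sq lam mu (C1_jac (S - \<omega>) (state lam mu f g \<Gamma> S) x))
            (closure (S - \<omega>)) - \<delta>) 0"

end

theory Submission
  imports Defs
begin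

text \<open>
  Write \<open>F t = Id + t X\<close>, \<open>S = \<Omega> - \<omega>\<close> and \<open>K = closure S\<close>. The field \<open>X\<close> vanishes on \<open>\<omega>\<close>, so the
  stress on the moved domain is taken over the closure of \<open>F t ` \<Omega> - \<omega> = F t ` S\<close>, which is \<open>F t ` K\<close>.
  Pulling everything back by \<open>F t\<close>, the moving maximum becomes a maximum over the fixed compact set
  \<open>K\<close>: by the chain rule, the Jacobian of the state on \<open>F t ` \<Omega>\<close> at the point \<open>F t x\<close> is
  \<open>G t x ** P t x\<close>, where \<open>G t\<close> is the Jacobian of the pulled back state and \<open>P t x\<close> is the inverse of
  \<open>mat 1 + t \<partial>X x\<close> (lemma \<open>max_von_mises_sq_image\<close>).

  The regularity assumption says that \<open>(G t - G 0) / t\<close> converges uniformly on \<open>K\<close> to the Jacobian of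
  the material derivative. As \<open>P t\<close> is \<open>mat 1 - t \<partial>X\<close> to first order, \<open>(G t ** P t - G 0) / t\<close>
  converges uniformly to \<open>\<partial>udot - \<partial>u ** \<partial>X\<close> (lemma \<open>uniform_limit_inverse_perturbation\<close>). The squared
  von Mises stress is a quadratic form in the Jacobian, so its difference quotients
  converge uniformly to \<open>f_X\<close> (lemma \<open>quadratic_difference_quotient\<close>).

  Uniform convergence of difference quotients on a compact set is what Danskin's theorem needs
  (lemma \<open>danskin_directional_derivative\<close>): the maximum over \<open>K\<close> has as one-sided derivative the
  maximum of \<open>f_X\<close> over the set of maximisers. The three cases of the result are the one-sided
  derivative of the positive part (lemma \<open>positive_part_directional_derivative\<close>).

  The values and Jacobians of continuously differentiable representatives are picked by Hilbert's
  choice operator. They can be computed with because \<open>S\<close> is contained in the closure of its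
  interior, where two representatives, being continuous and equal almost everywhere, coincide
  (lemma \<open>C1_rep_unique\<close>).
\<close>


section \<open>Danskin's theorem\<close>

lemma max_over_attained:
  fixes h :: "'a::topological_space \<Rightarrow> real"
  assumes "compact S" "S \<noteq> {}" "continuous_on S h"
  shows "max_over h S \<in> h ` S" "\<And>y. y \<in> S \<Longrightarrow> h y \<le> max_over h S"
proof -
  obtain x where x: "x \<in> S" "\<And>y. y \<in> S \<Longrightarrow> h y \<le> h x"
    using continuous_attains_sup[OF assms] by blast
  have "max_over h S = h x"
    unfolding max_over_def by (rule Greatest_equality) (use x in auto)
  then show "max_over h S \<in> h ` S" "\<And>y. y \<in> S \<Longrightarrow> h y \<le> max_over h S"
    using x by auto
qed

text \<open>
  A maximiser of \<open>f\<close> among the maximisers of \<open>h0\<close> gives the lower bound for the difference quotient.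
  For the upper bound, \<open>h t \<le> h0 + t (f + e/2)\<close> suffices where \<open>f\<close> is at most its maximum over the
  maximisers plus \<open>e/2\<close>; the remaining points form a compact set without maximisers of \<open>h0\<close>.
\<close>
lemma danskin_directional_derivative:
  fixes h :: "real \<Rightarrow> 'a::t2_space \<Rightarrow> real" and h0 f :: "'a \<Rightarrow> real"
  assumes K: "compact K" "K \<noteq> {}"
    and h0: "continuous_on K h0" and f: "continuous_on K f"
    and h: "\<forall>\<^sub>F t in at_right 0. continuous_on K (h t)"
    and lim: "uniform_limit K (\<lambda>t x. (h t x - h0 x) / t) f (at_right 0)"
  shows "((\<lambda>t. (max_over (h t) K - max_over h0 K) / t) \<longlongrightarrow>
           max_over f {z\<in>K. h0 z = max_over h0 K}) (at_right 0)"
proof -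
  define m where "m = max_over h0 K"
  define A where "A = {z\<in>K. h0 z = m}"
  note max0 = max_over_attained[OF K h0, folded m_def]
  have "closedin (top_of_set K) A"
    unfolding A_def using continuous_closedin_preimage_constant[OF h0, of m] by simp
  then have A: "compact A" "A \<noteq> {}" "A \<subseteq> K"
    using K max0(1) closedin_compact_eq[OF K(1)] by (auto simp: A_def)
  note maxA = max_over_attained[OF A(1,2) continuous_on_subset[OF f A(3)]]
  define a where "a = max_over f A"
  obtain z where z: "z \<in> A" "f z = a" using maxA(1) by (auto simp: a_def)
  have "((\<lambda>t. (max_over (h t) K - m) / t) \<longlongrightarrow> a) (at_right 0)"
  proof (rule tendstoI)
    fix e :: real assume e: "e > 0"
    define C where "C = {x\<in>K. f x \<in> {a + e/2..}}"
    have "closedin (top_of_set K) C"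
      using continuous_closedin_preimage[OF f closed_atLeast[of "a + e/2"]]
      by (simp add: C_def vimage_def Int_def)
    then have C: "compact C" "C \<subseteq> K"
      using closedin_compact_eq[OF K(1)] by (auto simp: C_def)
    have CA: "h0 x < m" if "x \<in> C" for x
    proof -
      have "x \<notin> A" using that maxA(2)[of x] e by (auto simp: C_def a_def)
      then show ?thesis using that max0(2)[of x] by (fastforce simp: C_def A_def)
    qed
    \<comment> \<open>On \<open>C\<close> the function \<open>h0\<close> has a gap \<open>\<eta>\<close> to its maximum, which beats the perturbation of
        order \<open>t\<close>.\<close>
    obtain \<eta> where \<eta>: "\<eta> > 0" "\<And>x. x \<in> C \<Longrightarrow> h0 x \<le> m - \<eta>"
    proof (cases "C = {}")
      case False
      note mC = max_over_attained[OF C(1) False continuous_on_subset[OF h0 C(2)]]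
      show thesis
        by (rule that[of "m - max_over h0 C"]) (use mC CA in auto)
    qed (use that[of 1] in auto)
    obtain B where B: "\<And>x. x \<in> K \<Longrightarrow> \<bar>f x\<bar> \<le> B"
      using compact_imp_bounded[OF compact_continuous_image[OF f K(1)]]
      unfolding bounded_iff by auto
    have small: "\<forall>\<^sub>F t in at_right 0. t * (B + e - a) < \<eta>"
      by (rule order_tendstoD(2)[OF _ \<eta>(1)]) (auto intro!: tendsto_eq_intros)
    have pos: "\<forall>\<^sub>F t in at_right 0. (0::real) < t"
      by (simp add: eventually_at_right_less)
    from uniform_limitD[OF lim, of "e/2"] e
    have "\<forall>\<^sub>F t in at_right 0. \<forall>x\<in>K. dist ((h t x - h0 x) / t) (f x) < e/2" by simp
    then show "\<forall>\<^sub>F t in at_right 0. dist ((max_over (h t) K - m) / t) a < e"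
      using h small pos
    proof eventually_elim
      case (elim t)
      note maxt = max_over_attained[OF K elim(2)]
      have bd: "h t x < h0 x + t * (f x + e/2)" "h t x > h0 x + t * (f x - e/2)"
        if "x \<in> K" for x
      proof -
        have "\<bar>(h t x - h0 x) / t - f x\<bar> < e/2"
          using elim(1) that by (auto simp: dist_real_def)
        then have "(h t x - h0 x) / t < f x + e/2" "f x - e/2 < (h t x - h0 x) / t"
          by linarith+
        then show "h t x < h0 x + t * (f x + e/2)" "h t x > h0 x + t * (f x - e/2)"
          using \<open>t > 0\<close> by (auto simp: field_simps)
      qed
      have "h t x < m + t * (a + e)" if x: "x \<in> K" for x
      proof (cases "x \<in> C")
        case True
        have "t * (f x + e/2) \<le> t * (B + e)"
          using B[OF x] e \<open>t > 0\<close> by (intro mult_left_mono) auto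
        moreover have "t * (B + e) < \<eta> + t * a" using elim(3) by (simp add: algebra_simps)
        moreover have "0 < t * e" using e \<open>t > 0\<close> by simp
        ultimately show ?thesis
          using bd(1)[OF x] \<eta>(2)[OF True] by (simp add: algebra_simps)
      next
        case False
        then have "f x < a + e/2" using x by (auto simp: C_def)
        then have "t * (f x + e/2) < t * (a + e)"
          using \<open>t > 0\<close> by simp
        then show ?thesis using bd(1)[OF x] max0(2)[OF x] by linarith
      qed
      then have up: "max_over (h t) K < m + t * (a + e)" using maxt(1) by auto
      have zK: "z \<in> K" "h0 z = m" using z(1) by (auto simp: A_def)
      have "m + t * (a - e/2) < max_over (h t) K"
        using bd(2)[OF zK(1)] maxt(2)[OF zK(1)] z(2) zK(2) by simp
      moreover have "t * (a - e) < t * (a - e/2)" using e \<open>t > 0\<close> by simp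
      ultimately have lo: "m + t * (a - e) < max_over (h t) K" by linarith
      have "(max_over (h t) K - m) / t < a + e" "a - e < (max_over (h t) K - m) / t"
        using up lo \<open>t > 0\<close> by (auto simp: field_simps)
      then show ?case by (auto simp: dist_real_def)
    qed
  qed
  then show ?thesis by (simp add: a_def A_def m_def)
qed

lemma positive_part_directional_derivative:
  fixes m :: "real \<Rightarrow> real"
  assumes m: "((\<lambda>t. (m t - m0) / t) \<longlongrightarrow> d) (at_right 0)"
  shows "((\<lambda>t. (max (m t - \<delta>) 0 - max (m0 - \<delta>) 0) / t) \<longlongrightarrow>
          (if m0 > \<delta> then d else if m0 = \<delta> then max d 0 else 0)) (at_right 0)"
proof -
  have pos: "\<forall>\<^sub>F t in at_right 0. (0::real) < t"
    by (simp add: eventually_at_right_less)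
  have "((\<lambda>t. m0 + t * ((m t - m0) / t)) \<longlongrightarrow> m0) (at_right 0)"
    by (rule tendsto_eq_intros m refl tendsto_ident_at | simp)+
  then have mt: "(m \<longlongrightarrow> m0) (at_right 0)"
    by (rule Lim_transform_eventually) (use pos in eventually_elim, simp)
  consider "m0 > \<delta>" | "m0 = \<delta>" | "m0 < \<delta>" by linarith
  then show ?thesis
  proof cases
    case 1
    have "\<forall>\<^sub>F t in at_right 0. m t > \<delta>" using order_tendstoD(1)[OF mt 1] .
    then have "\<forall>\<^sub>F t in at_right 0. (m t - m0) / t = (max (m t - \<delta>) 0 - max (m0 - \<delta>) 0) / t"
      by eventually_elim (use 1 in auto)
    then show ?thesis using Lim_transform_eventually[OF m] 1 by simp
  next
    case 2
    have "((\<lambda>t. max ((m t - m0) / t) 0) \<longlongrightarrow> max d 0) (at_right 0)"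
      by (intro tendsto_intros m)
    moreover have "\<forall>\<^sub>F t in at_right 0. max ((m t - m0) / t) 0
        = (max (m t - \<delta>) 0 - max (m0 - \<delta>) 0) / t"
      using pos
      by eventually_elim (use 2 in \<open>auto simp: max_def field_simps split: if_splits\<close>)
    ultimately show ?thesis using Lim_transform_eventually 2 by simp
  next
    case 3
    have "\<forall>\<^sub>F t in at_right 0. m t < \<delta>" using order_tendstoD(2)[OF mt 3] .
    then have "\<forall>\<^sub>F t in at_right 0. 0 = (max (m t - \<delta>) 0 - max (m0 - \<delta>) 0) / t"
      by eventually_elim (use 3 in auto)
    from Lim_transform_eventually[OF tendsto_const this] 3 show ?thesis by simp
  qed
qed


section \<open>Uniqueness of continuously differentiable representatives\<close>

lemma AE_lebesgue_on_iff_negligible: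
  assumes "S \<in> sets lebesgue"
  shows "(AE x in lebesgue_on S. P x) \<longleftrightarrow> negligible {x\<in>S. \<not> P x}"
proof -
  have "(AE x in lebesgue_on S. P x) \<longleftrightarrow> (AE x in lebesgue. x \<in> S \<longrightarrow> P x)"
    by (rule AE_restrict_space_iff) (use assms in simp)
  also have "\<dots> \<longleftrightarrow> negligible {x\<in>S. \<not> P x}"
    by (simp add: completion.AE_iff_null_sets negligible_iff_null_sets)
  finally show ?thesis .
qed

text \<open>
  The continuous functions differ on a relatively open subset of the interior of \<open>S\<close>, and a nonempty
  open set is not negligible; the density assumption carries equality to the whole closure.
\<close>
lemma continuous_eq_if_AE_eq:
  fixes V W :: "real^'n::finite \<Rightarrow> 'b::real_normed_vector"
  assumes S: "S \<in> sets lebesgue" "closure S \<subseteq> closure (interior S)"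
    and cont: "continuous_on (closure S) V" "continuous_on (closure S) W"
    and ae: "AE x in lebesgue_on S. V x = W x"
    and x: "x \<in> closure S"
  shows "V x = W x"
proof -
  have cs: "closure (interior S) \<subseteq> closure S" by (simp add: closure_mono interior_subset)
  have c: "continuous_on (closure S) (\<lambda>x. V x - W x)" by (intro continuous_intros cont)
  have "open {x\<in>interior S. V x - W x \<in> - {0}}"
  proof (rule continuous_open_preimage[unfolded vimage_def Int_def mem_Collect_eq])
    show "continuous_on (interior S) (\<lambda>x. V x - W x)"
      by (rule continuous_on_subset[OF c]) (meson closure_subset interior_subset order_trans)
  qed auto
  moreover have "negligible {x\<in>interior S. V x - W x \<in> - {0}}"
    by (rule negligible_subset[OF ae[unfolded AE_lebesgue_on_iff_negligible[OF S(1)]]])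
      (use interior_subset in auto)
  ultimately have "{x\<in>interior S. V x - W x \<in> - {0}} = {}"
    using open_not_negligible by blast
  then have "V x - W x = 0" if "x \<in> interior S" for x using that by auto
  then have "V x - W x = 0"
    using continuous_constant_on_closure[OF continuous_on_subset[OF c cs], of 0 x] x S(2) by blast
  then show ?thesis by simp
qed

lemma C1_rep_unique:
  fixes V W :: "real^'n::finite \<Rightarrow> real^'n"
  assumes S: "S \<in> sets lebesgue" "closure S \<subseteq> closure (interior S)"
    and V: "C1_rep S v V G" and W: "C1_rep S v W H" and x: "x \<in> closure S"
  shows "V x = W x" "G x = H x"
proof -
  have "AE x in lebesgue_on S. V x = v x" "AE x in lebesgue_on S. W x = v x"
    using V W by (auto simp: C1_rep_def)
  then have "AE x in lebesgue_on S. V x = W x" by eventually_elim simp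
  then have eq: "V y = W y" if "y \<in> closure S" for y
    using continuous_eq_if_AE_eq[OF S _ _ _ that] V W by (auto simp: C1_rep_def)
  show "V x = W x" using eq x .
  have dG: "G y = H y" if y: "y \<in> interior S" for y
  proof -
    have y': "y \<in> interior (closure S)" using y interior_mono[OF closure_subset] by blast
    have "(V has_derivative (\<lambda>h. G y *v h)) (at y)" "(W has_derivative (\<lambda>h. H y *v h)) (at y)"
      using V W y' by (auto simp: C1_rep_def)
    moreover have "(V has_derivative (\<lambda>h. H y *v h)) (at y)"
    proof (rule has_derivative_transform_within_open[OF _ open_interior y])
      show "(W has_derivative (\<lambda>h. H y *v h)) (at y)" by fact
      show "W z = V z" if "z \<in> interior S" for z
        using eq[of z] subsetD[OF closure_subset subsetD[OF interior_subset that]] by simp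
    qed
    ultimately have "(\<lambda>h. G y *v h) = (\<lambda>h. H y *v h)" using has_derivative_unique by blast
    then show ?thesis by (simp add: matrix_eq fun_eq_iff)
  qed
  have "continuous_on (closure (interior S)) (\<lambda>x. G x - H x)"
    using V W
    by (intro continuous_on_subset[OF continuous_on_diff closure_mono[OF interior_subset]])
      (simp_all add: C1_rep_def)
  then have "G x - H x = 0"
    using continuous_constant_on_closure[of "interior S" "\<lambda>x. G x - H x" 0 x] dG x S(2) by auto
  then show "G x = H x" by simp
qed

text \<open>
  \<^const>\<open>C1_val\<close> and \<^const>\<open>C1_jac\<close> are chosen independently of each other, so they need not be the two
  components of one representative; uniqueness makes this invisible on the closure.
\<close>
lemma C1_rep_values:
  assumes S: "S \<in> sets lebesgue" "closure S \<subseteq> closure (interior S)"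
    and V: "C1_rep S v V G" and x: "x \<in> closure S"
  shows "C1_val S v x = V x" "C1_jac S v x = G x"
proof -
  have "\<exists>G. C1_rep S v (C1_val S v) G"
    unfolding C1_val_def by (rule someI[where x=V]) (use V in blast)
  then show "C1_val S v x = V x" using C1_rep_unique(1)[OF S _ V x] by blast
  have "\<exists>W. C1_rep S v W (C1_jac S v)"
    unfolding C1_jac_def by (rule someI[where x=G]) (use V in blast)
  then show "C1_jac S v x = G x" using C1_rep_unique(2)[OF S _ V x] by blast
qed

lemma C1_rep_C1_jac:
  assumes S: "S \<in> sets lebesgue" "closure S \<subseteq> closure (interior S)" and "in_C1 S v"
  shows "\<exists>V. C1_rep S v V (C1_jac S v)"
proof -
  have "\<exists>G V. C1_rep S v V G" using assms by (auto simp: in_C1_def)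
  then show ?thesis unfolding C1_jac_def by (rule someI_ex)
qed

text \<open>
  This turns convergence in the \<open>C\<^sup>1\<close> norm into uniform convergence of Jacobians. Compactness keeps
  the two suprema from being suprema of unbounded sets.
\<close>
lemma norm_le_C1_norm:
  assumes S: "S \<in> sets lebesgue" "closure S \<subseteq> closure (interior S)"
    and cpt: "compact (closure S)"
    and V: "C1_rep S v V G" and x: "x \<in> closure S"
  shows "norm (G x) \<le> C1_norm S v"
proof -
  have bdd: "bdd_above ((\<lambda>x. norm (H x)) ` closure S)"
    if "continuous_on (closure S) H" for H :: "_ \<Rightarrow> 'b::real_normed_vector"
    using compact_imp_bounded[OF compact_continuous_image[OF continuous_on_norm[OF that] cpt]]
    by (rule bounded_imp_bdd_above)
  have c: "continuous_on (closure S) V" "continuous_on (closure S) G"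
    using V by (auto simp: C1_rep_def)
  have "C1_norm S v = (SUP x\<in>closure S. norm (V x)) + (SUP x\<in>closure S. norm (G x))"
    unfolding C1_norm_def
    using C1_rep_values[OF S V] by (simp cong: SUP_cong)
  moreover have "norm (V x) \<le> (SUP x\<in>closure S. norm (V x))"
    "norm (G x) \<le> (SUP x\<in>closure S. norm (G x))"
    using cSUP_upper[OF x bdd[OF c(1)]] cSUP_upper[OF x bdd[OF c(2)]] .
  ultimately show ?thesis using norm_ge_zero[of "V x"] by linarith
qed

lemma C1_rep_diff:
  assumes "C1_rep S v V G" "C1_rep S w W H"
  shows "C1_rep S (\<lambda>x. v x - w x) (\<lambda>x. V x - W x) (\<lambda>x. G x - H x)"
  unfolding C1_rep_def
proof (intro conjI ballI)
  have "AE x in lebesgue_on S. V x = v x" "AE x in lebesgue_on S. W x = w x"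
    using assms by (auto simp: C1_rep_def)
  then show "AE x in lebesgue_on S. V x - W x = v x - w x" by eventually_elim simp
  show "((\<lambda>x. V x - W x) has_derivative (\<lambda>h. (G x - H x) *v h)) (at x)"
    if "x \<in> interior (closure S)" for x
    using assms that
    by (auto simp: C1_rep_def matrix_vector_mult_diff_rdistrib intro!: has_derivative_diff)
qed (use assms in \<open>auto simp: C1_rep_def intro!: continuous_intros\<close>)

lemma C1_rep_scaleR:
  assumes "C1_rep S v V G"
  shows "C1_rep S (\<lambda>x. c *\<^sub>R v x) (\<lambda>x. c *\<^sub>R V x) (\<lambda>x. c *\<^sub>R G x)"
  unfolding C1_rep_def
proof (intro conjI ballI)
  have "AE x in lebesgue_on S. V x = v x"
    using assms by (auto simp: C1_rep_def)
  then show "AE x in lebesgue_on S. c *\<^sub>R V x = c *\<^sub>R v x" by eventually_elim simp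
  show "((\<lambda>x. c *\<^sub>R V x) has_derivative (\<lambda>h. (c *\<^sub>R G x) *v h)) (at x)"
    if "x \<in> interior (closure S)" for x
    using has_derivative_scaleR_right[of V "\<lambda>h. G x *v h" "at x" c] assms that
    by (simp add: C1_rep_def scaleR_matrix_vector_assoc)
qed (use assms in \<open>auto simp: C1_rep_def intro!: continuous_on_scaleR continuous_on_const\<close>)

lemma C1_norm_zero:
  assumes D: "open D" "D \<noteq> {}"
  shows "C1_norm D (\<lambda>_. 0) = 0"
proof -
  have S: "D \<in> sets lebesgue" "closure D \<subseteq> closure (interior D)"
    using D by (auto simp: interior_open)
  have "C1_rep D (\<lambda>_. 0) (\<lambda>_. 0) (\<lambda>_. 0)" by (simp add: C1_rep_def)
  note * = C1_rep_values[OF S this]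
  have "(SUP x\<in>closure D. norm (C1_val D (\<lambda>_. 0) x)) = (SUP x\<in>closure D. 0)"
    "(SUP x\<in>closure D. norm (C1_jac D (\<lambda>_. 0) x)) = (SUP x\<in>closure D. 0)"
    using * by (simp_all cong: SUP_cong)
  then show ?thesis using D unfolding C1_norm_def by simp
qed


section \<open>Matrix algebra and the von Mises form\<close>

lemma matrix_add_rdistrib: "(A + B) ** C = A ** C + B ** (C :: 'a::semiring_1^'k^'m)"
  by (simp add: vec_eq_iff matrix_matrix_mult_def sum.distrib distrib_right)

lemma bounded_bilinear_matrix_matrix_mult:
  "bounded_bilinear ((**) :: real^'m^'n \<Rightarrow> real^'k^'m \<Rightarrow> real^'k^'n)"
  unfolding bilinear_conv_bounded_bilinear[symmetric] bilinear_def linear_iff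
  by (simp add: matrix_add_ldistrib matrix_add_rdistrib scalar_matrix_assoc matrix_scalar_ac)

lemma bounded_bilinear_matrix_vector_mult:
  "bounded_bilinear ((*v) :: real^'m^'n \<Rightarrow> real^'m \<Rightarrow> real^'n)"
  unfolding bilinear_conv_bounded_bilinear[symmetric] bilinear_def
proof (intro conjI allI)
  show "linear (\<lambda>M :: real^'m^'n. M *v h)" for h
    by (rule linearI)
      (rule matrix_vector_mult_add_rdistrib, rule scaleR_matrix_vector_assoc[symmetric])
qed (rule matrix_vector_mul_linear)

text \<open>The polar form of the quadratic form \<^const>\<open>von_mises_sq\<close>.\<close>
definition von_mises_form :: "real \<Rightarrow> real \<Rightarrow> real^'n^'n \<Rightarrow> real^'n::finite^'n \<Rightarrow> real" where
  "von_mises_form lam mu M N = tensor_B lam mu (sym_part M) \<bullet> sym_part N"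

lemma sym_part_add: "sym_part (M + N) = sym_part M + sym_part N"
  by (simp add: sym_part_def transpose_def vec_eq_iff algebra_simps)

lemma sym_part_scaleR: "sym_part (c *\<^sub>R M) = c *\<^sub>R sym_part M"
  by (simp add: sym_part_def transpose_def vec_eq_iff algebra_simps)

lemma tensor_B_add: "tensor_B lam mu (M + N) = tensor_B lam mu M + tensor_B lam mu N"
  by (simp add: tensor_B_def trace_add algebra_simps)

lemma tensor_B_scaleR: "tensor_B lam mu (c *\<^sub>R M) = c *\<^sub>R tensor_B lam mu M"
proof -
  have "trace (c *\<^sub>R M) = c * trace M" by (simp add: trace_def sum_distrib_left)
  then show ?thesis by (simp add: tensor_B_def algebra_simps)
qed

lemma mat_1_inner: "mat 1 \<bullet> (M :: real^'n::finite^'n) = trace M"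
proof -
  have "mat 1 \<bullet> M = (\<Sum>i\<in>UNIV. \<Sum>j\<in>UNIV. if i = j then M $ i $ j else 0)"
    unfolding inner_vec_def mat_def by (intro sum.cong refl) simp
  then show ?thesis by (simp add: trace_def)
qed

lemma von_mises_form_commute: "von_mises_form lam mu M N = von_mises_form lam mu N M"
  by (simp add: von_mises_form_def tensor_B_def inner_add_left mat_1_inner
      inner_commute[of "sym_part M" "sym_part N"])

lemma bounded_bilinear_von_mises_form:
  "bounded_bilinear (von_mises_form lam mu :: real^'n^'n \<Rightarrow> real^'n::finite^'n \<Rightarrow> real)"
  unfolding bilinear_conv_bounded_bilinear[symmetric] bilinear_def linear_iff
  by (simp add: von_mises_form_def sym_part_add sym_part_scaleR tensor_B_add tensor_B_scaleR
      inner_add_left inner_add_right)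

lemma von_mises_sq_eq_form: "von_mises_sq lam mu M = von_mises_form lam mu M M"
  by (simp add: von_mises_sq_def von_mises_form_def)

text \<open>
  The unsymmetrised sum \<open>M + transpose M\<close>, with \<open>M = \<partial>u ** \<partial>X\<close>, is how the second term of
  \<open>f_X\<close> is written.
\<close>
lemma von_mises_form_eq_tensor_B:
  "2 * von_mises_form lam mu M N = tensor_B lam mu (M + transpose M) \<bullet> sym_part N"
proof -
  have "M + transpose M = 2 *\<^sub>R sym_part M" by (simp add: sym_part_def)
  then show ?thesis by (simp add: von_mises_form_def tensor_B_scaleR)
qed


section \<open>Uniform difference quotients\<close>

lemma uniform_limit_if_difference_quotient:
  fixes G :: "real \<Rightarrow> 'a \<Rightarrow> 'b::real_normed_vector"
  assumes "uniform_limit K (\<lambda>t x. (G t x - G0 x) /\<^sub>R t) G' (at_right 0)" "bounded (G' ` K)"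
  shows "uniform_limit K G G0 (at_right 0)"
proof -
  have "uniform_limit K (\<lambda>t x. t) (\<lambda>x. 0) (at_right (0::real))"
    by (rule uniform_limitI) (auto simp: eventually_at dist_real_def intro!: exI)
  from bounded_bilinear.bounded_uniform_limit[OF bounded_bilinear_scaleR this assms(1) assms(2)]
  have "uniform_limit K (\<lambda>t x. t *\<^sub>R ((G t x - G0 x) /\<^sub>R t)) (\<lambda>x. 0) (at_right 0)"
    by (simp add: image_constant_conv)
  then have "uniform_limit K (\<lambda>t x. G0 x + t *\<^sub>R ((G t x - G0 x) /\<^sub>R t)) (\<lambda>x. G0 x + 0) (at_right 0)"
    by (rule uniform_limit_add[OF uniform_limit_const])
  moreover have "\<forall>\<^sub>F t in at_right 0. \<forall>x\<in>K. G0 x + t *\<^sub>R ((G t x - G0 x) /\<^sub>R t) = G t x"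
    using eventually_at_right_less[of 0] by eventually_elim auto
  ultimately show ?thesis
    by (rule iffD1[OF uniform_limit_cong, rotated 2]) simp_all
qed

text \<open>
  By symmetry \<open>b y y - b x x = b (y - x) (y + x)\<close>, which reduces the claim to the limit of a product.
\<close>
lemma quadratic_difference_quotient:
  fixes b :: "'b::real_normed_vector \<Rightarrow> 'b \<Rightarrow> real"
  assumes b: "bounded_bilinear b" and sym: "\<And>x y. b x y = b y x"
    and lim: "uniform_limit K (\<lambda>t x. (G t x - G0 x) /\<^sub>R t) G' (at_right 0)"
    and bdd: "bounded (G' ` K)" "bounded (G0 ` K)"
  shows "uniform_limit K (\<lambda>t x. (b (G t x) (G t x) - b (G0 x) (G0 x)) / t)
           (\<lambda>x. 2 * b (G0 x) (G' x)) (at_right 0)"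
proof -
  interpret b: bounded_bilinear b by fact
  have "uniform_limit K (\<lambda>t x. G t x + G0 x) (\<lambda>x. G0 x + G0 x) (at_right 0)"
    by (intro uniform_limit_add uniform_limit_const uniform_limit_if_difference_quotient[OF lim bdd(1)])
  moreover have "bounded ((\<lambda>x. G0 x + G0 x) ` K)" using bdd(2) bdd(2) by (rule bounded_plus_comp)
  ultimately have "uniform_limit K (\<lambda>t x. b ((G t x - G0 x) /\<^sub>R t) (G t x + G0 x))
      (\<lambda>x. b (G' x) (G0 x + G0 x)) (at_right 0)"
    by (intro b.bounded_uniform_limit[OF lim _ _ bdd(1)])
  moreover have "b ((G t x - G0 x) /\<^sub>R t) (G t x + G0 x)
      = (b (G t x) (G t x) - b (G0 x) (G0 x)) / t" for t x
    by (simp add: b.scaleR_left b.diff_left b.add_right sym[of "G0 x" "G t x"] divide_inverse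
        algebra_simps)
  moreover have "b (G' x) (G0 x + G0 x) = 2 * b (G0 x) (G' x)" for x
    by (simp add: b.add_right sym[of "G' x"])
  ultimately show ?thesis by simp
qed


section \<open>Perturbations of the identity\<close>

text \<open>
  Once \<open>t\<close> times the Lipschitz constant of \<open>X\<close> is below \<open>1/2\<close>, the displacement \<open>t X\<close> is too short to
  identify two points, and its derivative too small to cancel a vector. The bound on the inverse
  \<open>P\<close> comes from \<open>P = mat 1 - t DX P\<close>, where the last term has norm at most half that of \<open>P\<close>.
\<close>
lemma small_perturbation_of_identity:
  fixes X :: "real^'n::finite \<Rightarrow> real^'n"
  assumes der: "\<And>x. (X has_derivative (\<lambda>h. DX x *v h)) (at x)"
    and bdd: "\<And>x. norm (DX x) \<le> B"
  shows "\<forall>\<^sub>F t in at_right 0. inj (\<lambda>x. x + t *\<^sub>R X x) \<and>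
     (\<forall>x. (mat 1 + t *\<^sub>R DX x) ** matrix_inv (mat 1 + t *\<^sub>R DX x) = mat 1 \<and>
          norm (matrix_inv (mat 1 + t *\<^sub>R DX x)) \<le> 2 * norm (mat 1 :: real^'n^'n))"
proof -
  interpret mv: bounded_bilinear "(*v) :: real^'n^'n \<Rightarrow> real^'n \<Rightarrow> real^'n"
    by (rule bounded_bilinear_matrix_vector_mult)
  obtain C where C: "C > 0" "\<And>A h. norm ((A::real^'n^'n) *v h) \<le> norm A * norm h * C"
    using bounded_bilinear.pos_bounded[OF bounded_bilinear_matrix_vector_mult[where 'm='n and 'n='n]]
    by metis
  obtain C' where C': "C' > 0" "\<And>A M. norm ((A::real^'n^'n) ** (M::real^'n^'n)) \<le> norm A * norm M * C'"
    using bounded_bilinear.pos_bounded[OF bounded_bilinear_matrix_matrix_mult[where 'm='n and 'n='n and 'k='n]]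
    by metis
  have DXh: "norm (DX x *v h) \<le> B * C * norm h" for x h
  proof -
    have "norm (DX x *v h) \<le> norm (DX x) * (norm h * C)"
      using C(2)[of "DX x" h] by (simp add: mult.assoc)
    also have "\<dots> \<le> B * (norm h * C)" using bdd C(1) by (intro mult_right_mono) auto
    finally show ?thesis by (simp add: mult_ac)
  qed
  have lip: "norm (X x - X y) \<le> B * C * norm (x - y)" for x y
    by (rule differentiable_bound[OF convex_UNIV, where f'="\<lambda>x h. DX x *v h"])
      (use der DXh in \<open>auto intro!: onorm_le\<close>)
  have "((\<lambda>t. t * (B * C)) \<longlongrightarrow> 0) (at_right 0)" "((\<lambda>t. t * (B * C')) \<longlongrightarrow> 0) (at_right 0)"
    by (auto intro!: tendsto_eq_intros)
  from order_tendstoD(2)[OF this(1), of "1/2"] order_tendstoD(2)[OF this(2), of "1/2"]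
  have "\<forall>\<^sub>F t in at_right 0. t * (B * C) < 1/2" "\<forall>\<^sub>F t in at_right 0. t * (B * C') < 1/2" by auto
  then show ?thesis using eventually_at_right_less[of 0]
  proof eventually_elim
    case (elim t)
    have zero: "v = 0" if "norm v \<le> t * (B * C * norm v)" for v :: "real^'n"
    proof (rule ccontr)
      assume "v \<noteq> 0"
      then have "t * (B * C) * norm v < 1/2 * norm v" using elim(1) by (intro mult_strict_right_mono) auto
      then show False using that norm_ge_zero[of v] by (simp add: mult.assoc)
    qed
    have "inj (\<lambda>x. x + t *\<^sub>R X x)"
    proof (rule injI)
      fix x y assume that: "x + t *\<^sub>R X x = y + t *\<^sub>R X y"
      have "x - y = t *\<^sub>R (X y - X x)" using that by (simp add: algebra_simps)
      then have "norm (x - y) = t * norm (X x - X y)"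
        using elim(3) by (simp add: norm_minus_commute)
      also have "\<dots> \<le> t * (B * C * norm (x - y))" using lip elim(3) by (intro mult_left_mono) auto
      finally show "x = y" using zero[of "x - y"] by simp
    qed
    moreover have inv: "(mat 1 + t *\<^sub>R DX x) ** matrix_inv (mat 1 + t *\<^sub>R DX x) = mat 1" for x
    proof -
      have "h = 0" if "(mat 1 + t *\<^sub>R DX x) *v h = 0" for h
      proof (rule zero)
        have "h = - (t *\<^sub>R (DX x *v h))"
          using that by (simp only: mv.add_left mv.scaleR_left matrix_vector_mul_lid
              eq_neg_iff_add_eq_0)
        then have "norm h = norm (t *\<^sub>R (DX x *v h))" by (metis norm_minus_cancel)
        then have "norm h = t * norm (DX x *v h)" using elim(3) by simp
        also have "\<dots> \<le> t * (B * C * norm h)" using DXh elim(3) by (intro mult_left_mono) auto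
        finally show "norm h \<le> t * (B * C * norm h)" .
      qed
      then have "invertible (mat 1 + t *\<^sub>R DX x)"
        by (metis invertible_left_inverse matrix_left_invertible_ker)
      then show ?thesis
        unfolding invertible_def matrix_inv_def by (rule someI2_ex) blast
    qed
    moreover have "norm (matrix_inv (mat 1 + t *\<^sub>R DX x)) \<le> 2 * norm (mat 1 :: real^'n^'n)" for x
    proof -
      let ?P = "matrix_inv (mat 1 + t *\<^sub>R DX x)"
      have "?P = mat 1 - t *\<^sub>R (DX x ** ?P)"
        using inv[of x] by (simp add: matrix_add_rdistrib scalar_matrix_assoc eq_diff_eq)
      then have "norm ?P \<le> norm (mat 1 :: real^'n^'n) + t * norm (DX x ** ?P)"
        using norm_triangle_ineq4[of "mat 1" "t *\<^sub>R (DX x ** ?P)"] elim(3) by simp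
      moreover have "t * norm (DX x ** ?P) \<le> 1/2 * norm ?P"
      proof -
        have "norm (DX x ** ?P) \<le> norm (DX x) * (norm ?P * C')"
          using C'(2)[of "DX x" ?P] by (simp add: mult.assoc)
        also have "\<dots> \<le> B * (norm ?P * C')" using bdd C'(1) by (intro mult_right_mono) auto
        finally have "t * norm (DX x ** ?P) \<le> t * (B * (norm ?P * C'))"
          using elim(3) by (intro mult_left_mono) auto
        also have "\<dots> = t * (B * C') * norm ?P" by (simp add: mult_ac)
        also have "\<dots> \<le> 1/2 * norm ?P" using elim(2) by (intro mult_right_mono) auto
        finally show ?thesis .
      qed
      ultimately show ?thesis by linarith
    qed
    ultimately show ?case by blast
  qed
qed

text \<open>The resolvent identity \<open>P x - P a = P x ** (M a - M x) ** P a\<close> bounds the increments of \<open>P\<close>.\<close>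
lemma continuous_on_right_inverse_matrix:
  fixes M P :: "'a::topological_space \<Rightarrow> real^'n::finite^'n"
  assumes M: "continuous_on S M" and inv: "\<And>x. x \<in> S \<Longrightarrow> M x ** P x = mat 1"
    and bdd: "\<And>x. x \<in> S \<Longrightarrow> norm (P x) \<le> B"
  shows "continuous_on S P"
  unfolding continuous_on_def
proof
  fix a assume a: "a \<in> S"
  interpret mm: bounded_bilinear "(**) :: real^'n^'n \<Rightarrow> real^'n^'n \<Rightarrow> real^'n^'n"
    by (rule bounded_bilinear_matrix_matrix_mult)
  obtain C where C: "\<And>A N. norm ((A::real^'n^'n) ** (N::real^'n^'n)) \<le> norm A * norm N * C" "C > 0"
    using mm.pos_bounded by metis
  have "((\<lambda>x. (M a - M x) ** P a) \<longlongrightarrow> (M a - M a) ** P a) (at a within S)"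
    using M a by (intro mm.tendsto tendsto_intros) (auto simp: continuous_on_def)
  from tendsto_mult_left[OF tendsto_norm[OF this], of "B * C"]
  have lim: "((\<lambda>x. B * C * norm ((M a - M x) ** P a)) \<longlongrightarrow> 0) (at a within S)"
    by (simp add: mm.zero_left)
  have "norm (P x - P a) \<le> B * C * norm ((M a - M x) ** P a)" if x: "x \<in> S" for x
  proof -
    have "P x ** M x = mat 1" using inv[OF x] matrix_left_right_inverse by blast
    then have "P x ** ((M a - M x) ** P a) = P x - P a"
      using inv[OF a] by (simp add: mm.diff_left mm.diff_right matrix_mul_assoc)
    then have "norm (P x - P a) \<le> norm (P x) * (norm ((M a - M x) ** P a) * C)"
      using C(1)[of "P x" "(M a - M x) ** P a"] by (simp add: mult.assoc)
    also have "\<dots> \<le> B * (norm ((M a - M x) ** P a) * C)"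
      using bdd[OF x] C(2) by (intro mult_right_mono) auto
    finally show ?thesis by (simp add: mult_ac)
  qed
  then have "\<forall>\<^sub>F x in at a within S. norm (P x - P a) \<le> B * C * norm ((M a - M x) ** P a)"
    by (auto simp: eventually_at_filter)
  from Lim_null_comparison[OF this lim] show "(P \<longlongrightarrow> P a) (at a within S)"
    using Lim_null by blast
qed

text \<open>
  From \<open>P t - mat 1 = - t DX ** P t\<close> the difference quotient equals
  \<open>((G t - G0) / t - G0 ** DX) ** P t\<close>, and \<open>P t\<close> tends to \<open>mat 1\<close> uniformly.
\<close>
lemma uniform_limit_inverse_perturbation:
  fixes G0 G' DX :: "'a \<Rightarrow> real^'n::finite^'n" and P :: "real \<Rightarrow> 'a \<Rightarrow> real^'n^'n"
  assumes lim: "uniform_limit K (\<lambda>t x. (G t x - G0 x) /\<^sub>R t) G' (at_right 0)"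
    and bdd: "bounded (G' ` K)" "bounded (G0 ` K)" "bounded (DX ` K)"
    and P: "\<forall>\<^sub>F t in at_right 0. \<forall>x\<in>K. (mat 1 + t *\<^sub>R DX x) ** P t x = mat 1 \<and> norm (P t x) \<le> B"
  shows "uniform_limit K (\<lambda>t x. (G t x ** P t x - G0 x) /\<^sub>R t) (\<lambda>x. G' x - G0 x ** DX x) (at_right 0)"
proof -
  interpret mm: bounded_bilinear "(**) :: real^'n^'n \<Rightarrow> real^'n^'n \<Rightarrow> real^'n^'n"
    by (rule bounded_bilinear_matrix_matrix_mult)
  obtain C where C: "\<And>A N. norm ((A::real^'n^'n) ** (N::real^'n^'n)) \<le> norm A * norm N * C" "C > 0"
    using mm.pos_bounded by metis
  obtain b where b: "\<And>x. x \<in> K \<Longrightarrow> norm (DX x) \<le> b" "b > 0"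
    using bdd(3) by (auto simp: bounded_pos)
  note pos = eventually_at_right_less[of "0::real"]
  have P1: "P t x - mat 1 = - (t *\<^sub>R (DX x ** P t x))"
    if "(mat 1 + t *\<^sub>R DX x) ** P t x = mat 1" for t x
    using that by (simp add: matrix_add_rdistrib scalar_matrix_assoc algebra_simps)
  have t0: "uniform_limit K (\<lambda>t x. t * (b * B * C)) (\<lambda>x. 0) (at_right (0::real))"
  proof (rule uniform_limitI)
    fix e :: real assume "e > 0"
    have "((\<lambda>t. t * (b * B * C)) \<longlongrightarrow> 0) (at_right 0)" by (auto intro!: tendsto_eq_intros)
    from tendstoD[OF this \<open>e > 0\<close>]
    show "\<forall>\<^sub>F t in at_right 0. \<forall>x\<in>K. dist (t * (b * B * C)) 0 < e" by eventually_elim simp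
  qed
  have "uniform_limit K (\<lambda>t x. P t x - mat 1) (\<lambda>x. 0) (at_right 0)"
  proof (rule uniform_limit_null_comparison[OF _ t0])
    show "\<forall>\<^sub>F t in at_right 0. \<forall>x\<in>K. norm (P t x - mat 1) \<le> t * (b * B * C)"
      using P pos
    proof eventually_elim
      case (elim t)
      show ?case
      proof
        fix x assume x: "x \<in> K"
        have "norm (DX x ** P t x) \<le> norm (DX x) * norm (P t x) * C" using C(1) .
        also have "\<dots> \<le> b * B * C"
          using elim(1) b x C(2) by (intro mult_right_mono mult_mono) auto
        finally show "norm (P t x - mat 1) \<le> t * (b * B * C)"
          using P1[of t x] elim x by (simp add: mult_left_mono)
      qed
    qed
  qed
  from uniform_limit_add[OF this uniform_limit_const[where c="\<lambda>x. mat 1"]]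
  have Plim: "uniform_limit K P (\<lambda>x. mat 1) (at_right 0)" by simp
  have bd: "bounded ((\<lambda>x. G0 x ** DX x) ` K)"
  proof -
    obtain c where c: "\<And>x. x \<in> K \<Longrightarrow> norm (G0 x) \<le> c" "c > 0"
      using bdd(2) by (auto simp: bounded_pos)
    have "norm (G0 x ** DX x) \<le> c * b * C" if "x \<in> K" for x
    proof -
      have "norm (G0 x ** DX x) \<le> norm (G0 x) * norm (DX x) * C" using C(1) .
      also have "\<dots> \<le> c * b * C"
        using b c that C(2) by (intro mult_right_mono mult_mono) auto
      finally show ?thesis .
    qed
    then show ?thesis by (auto simp: bounded_iff)
  qed
  have "uniform_limit K (\<lambda>t x. ((G t x - G0 x) /\<^sub>R t - G0 x ** DX x) ** P t x)
      (\<lambda>x. (G' x - G0 x ** DX x) ** mat 1) (at_right 0)"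
    by (rule mm.bounded_uniform_limit[OF uniform_limit_minus[OF lim uniform_limit_const] Plim])
      (use bounded_minus_comp[OF bdd(1) bd] in \<open>auto simp: image_constant_conv\<close>)
  moreover have "\<forall>\<^sub>F t in at_right 0. \<forall>x\<in>K.
      ((G t x - G0 x) /\<^sub>R t - G0 x ** DX x) ** P t x = (G t x ** P t x - G0 x) /\<^sub>R t"
    using P pos
  proof eventually_elim
    case (elim t)
    show ?case
    proof
      fix x assume "x \<in> K"
      then have "P t x = mat 1 - t *\<^sub>R (DX x ** P t x)" using P1 elim(1) by (simp add: algebra_simps)
      then have "G0 x ** P t x = G0 x ** (mat 1 - t *\<^sub>R (DX x ** P t x))" by (rule arg_cong)
      then have "G0 x ** P t x = G0 x - t *\<^sub>R (G0 x ** DX x ** P t x)"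
        by (simp add: mm.diff_right mm.scaleR_right matrix_mul_assoc)
      then have "(G0 x ** DX x) ** P t x = (G0 x - G0 x ** P t x) /\<^sub>R t" using elim(2) by simp
      then show "((G t x - G0 x) /\<^sub>R t - G0 x ** DX x) ** P t x = (G t x ** P t x - G0 x) /\<^sub>R t"
        by (simp add: mm.diff_left mm.scaleR_left scaleR_diff_right)
    qed
  qed
  ultimately show ?thesis
    by (rule iffD1[OF uniform_limit_cong, rotated 2]) simp_all
qed


section \<open>Transport of continuously differentiable representatives\<close>

text \<open>
  The chain rule for representatives. The exceptional null set is moved to a null set because \<open>F\<close> is
  differentiable. Density of the interior is inherited by the image because \<open>F\<close> is an open map, by
  invariance of domain.
\<close>
lemma C1_rep_transport:
  fixes F :: "real^'n::finite \<Rightarrow> real^'n" and P :: "real^'n \<Rightarrow> real^'n^'n"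
  assumes F: "inj F" "\<And>x. (F has_derivative (\<lambda>h. M x *v h)) (at x)"
    and P: "\<And>x. M x ** P x = mat 1" "continuous_on UNIV P"
    and S: "S \<in> sets lebesgue" "F ` S \<in> sets lebesgue" "compact (closure S)"
    and rep: "C1_rep S (v \<circ> F) V G"
  shows "C1_rep (F ` S) v (V \<circ> inv F) (\<lambda>y. G (inv F y) ** P (inv F y))"
    and "closure (F ` S) = F ` closure S"
    and "closure S \<subseteq> closure (interior S) \<Longrightarrow> closure (F ` S) \<subseteq> closure (interior (F ` S))"
proof -
  interpret mm: bounded_bilinear "(**) :: real^'n^'n \<Rightarrow> real^'n^'n \<Rightarrow> real^'n^'n"
    by (rule bounded_bilinear_matrix_matrix_mult)
  have diff: "F differentiable (at x)" for x using F(2) differentiableI by blast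
  have contF: "continuous_on T F" for T
    using diff by (meson differentiable_imp_continuous_within continuous_at_imp_continuous_on)
  have invF: "inv F (F x) = x" for x using F(1) by simp
  have img_closure: "F ` closure T = closure (F ` T)" if "compact (closure T)" for T
  proof
    show "F ` closure T \<subseteq> closure (F ` T)"
      by (rule image_closure_subset[OF contF closed_closure closure_subset])
    have "closed (F ` closure T)" using compact_continuous_image[OF contF that] compact_imp_closed by blast
    then show "closure (F ` T) \<subseteq> F ` closure T"
      by (intro closure_minimal image_mono closure_subset)
  qed
  show cl: "closure (F ` S) = F ` closure S" using img_closure[OF S(3)] by simp
  show "closure (F ` S) \<subseteq> closure (interior (F ` S))" if dense: "closure S \<subseteq> closure (interior S)"
  proof -
    have "open (F ` interior S)"
      by (rule invariance_of_domain[OF contF open_interior]) (use F(1) in \<open>auto intro: inj_on_subset\<close>)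
    then have "F ` interior S \<subseteq> interior (F ` S)"
      by (intro interior_maximal image_mono interior_subset)
    moreover have "F ` closure (interior S) \<subseteq> closure (F ` interior S)"
      by (rule image_closure_subset[OF contF closed_closure closure_subset])
    ultimately show ?thesis unfolding cl using dense closure_mono by blast
  qed
  have contI: "continuous_on (F ` closure S) (inv F)"
    by (rule continuous_on_inv[OF contF S(3)]) (use invF in blast)
  have imI: "inv F ` F ` closure S = closure S" using F(1) by (simp add: image_inv_f_f)
  show "C1_rep (F ` S) v (V \<circ> inv F) (\<lambda>y. G (inv F y) ** P (inv F y))"
    unfolding C1_rep_def cl
  proof (intro conjI ballI)
    have "negligible {x\<in>S. V x \<noteq> (v \<circ> F) x}"
      using rep AE_lebesgue_on_iff_negligible[OF S(1)] by (auto simp: C1_rep_def)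
    then have "negligible (F ` {x\<in>S. V x \<noteq> (v \<circ> F) x})"
      by (rule negligible_differentiable_image_negligible[OF order_refl])
        (use diff in \<open>auto simp: differentiable_on_def intro: differentiable_at_withinI\<close>)
    moreover have "F ` {x\<in>S. V x \<noteq> (v \<circ> F) x} = {y\<in>F ` S. (V \<circ> inv F) y \<noteq> v y}"
      by (auto simp: invF)
    ultimately show "AE y in lebesgue_on (F ` S). (V \<circ> inv F) y = v y"
      by (simp add: AE_lebesgue_on_iff_negligible[OF S(2)])
    show "continuous_on (F ` closure S) (V \<circ> inv F)"
      by (rule continuous_on_compose[OF contI]) (use rep imI in \<open>simp add: C1_rep_def\<close>)
    have "continuous_on (closure S) (\<lambda>x. G x ** P x)"
      using rep P(2) by (intro mm.continuous_on) (auto simp: C1_rep_def intro: continuous_on_subset)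
    from continuous_on_compose2[OF this contI] imI
    show "continuous_on (F ` closure S) (\<lambda>y. G (inv F y) ** P (inv F y))" by auto
    fix y assume y: "y \<in> interior (F ` closure S)"
    then obtain x where x: "y = F x" "x \<in> closure S" using interior_subset by blast
    \<comment> \<open>The preimage of the interior is an open subset of \<open>closure S\<close>, so \<open>x\<close> is an interior point.\<close>
    have "open (F -` interior (F ` closure S))"
      by (rule open_vimage[OF open_interior contF])
    moreover have "F -` interior (F ` closure S) \<subseteq> closure S"
    proof
      fix z assume "z \<in> F -` interior (F ` closure S)"
      then have "F z \<in> F ` closure S" using interior_subset by blast
      then show "z \<in> closure S" using F(1) by (simp add: inj_image_mem_iff)
    qed
    ultimately have "x \<in> interior (closure S)" using y x(1)
      by (intro interiorI[of "F -` interior (F ` closure S)"]) simp_all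
    then have dV: "(V has_derivative (\<lambda>h. G x *v h)) (at (inv F y))"
      using rep by (simp add: C1_rep_def x(1) invF)
    have "(inv F has_derivative (\<lambda>h. P x *v h)) (at (F x))"
      by (rule has_derivative_inverse_strong[OF open_UNIV UNIV_I contF invF F(2)])
        (auto simp: fun_eq_iff matrix_vector_mul_assoc P(1))
    then have "(V \<circ> inv F has_derivative (\<lambda>h. G x *v h) \<circ> (\<lambda>h. P x *v h)) (at y)"
      unfolding x(1)[symmetric] using dV by (rule diff_chain_at)
    then show "(V \<circ> inv F has_derivative (\<lambda>h. (G (inv F y) ** P (inv F y)) *v h)) (at y)"
      by (simp add: x(1) invF comp_def matrix_vector_mul_assoc)
  qed
qed


text \<open>
  Substitute \<open>y = F x\<close>. The density of the interior of \<open>S\<close> passes to \<open>F ` S\<close>, so the Jacobian chosen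
  there must be the transported one.
\<close>
lemma max_von_mises_sq_image:
  fixes F :: "real^'n::finite \<Rightarrow> real^'n" and P :: "real^'n \<Rightarrow> real^'n^'n"
  assumes F: "inj F" "\<And>x. (F has_derivative (\<lambda>h. M x *v h)) (at x)"
    and P: "\<And>x. M x ** P x = mat 1" "continuous_on UNIV P"
    and S: "S \<in> sets lebesgue" "F ` S \<in> sets lebesgue" "compact (closure S)"
      "closure S \<subseteq> closure (interior S)"
    and rep: "C1_rep S (v \<circ> F) V G"
  shows "max_over (\<lambda>y. von_mises_sq lam mu (C1_jac (F ` S) v y)) (closure (F ` S)) =
         max_over (\<lambda>x. von_mises_sq lam mu (G x ** P x)) (closure S)"
proof -
  note transport = C1_rep_transport[OF F P S(1-3) rep]
  have "C1_jac (F ` S) v (F x) = G x ** P x" if "x \<in> closure S" for x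
    using C1_rep_values(2)[OF S(2) transport(3)[OF S(4)] transport(1), of "F x"] that F(1)
    by (simp add: transport(2))
  then have "(\<lambda>y. von_mises_sq lam mu (C1_jac (F ` S) v y)) ` closure (F ` S) =
      (\<lambda>x. von_mises_sq lam mu (G x ** P x)) ` closure S"
    unfolding transport(2) image_image by (intro image_cong refl) simp
  then show ?thesis by (simp add: max_over_def)
qed

text \<open>
  Inside \<open>\<Omega>\<close> the interior of \<open>K = closure (\<Omega> - \<omega>)\<close> adds no points to \<open>\<Omega> - \<omega>\<close>, since \<open>K\<close> avoids the
  open set \<open>\<omega>\<close>; and every nonempty open subset of \<open>K\<close> meets \<open>\<Omega>\<close>.
\<close>
lemma closure_diff_subset_closure_interior:
  fixes \<Omega> :: "'a::topological_space set"
  assumes "open \<Omega>" "open \<omega>" "closure (\<Omega> - \<omega>) = closure (interior (closure (\<Omega> - \<omega>)))"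
  shows "closure (\<Omega> - \<omega>) \<subseteq> closure (interior (\<Omega> - \<omega>))"
proof -
  let ?K = "closure (\<Omega> - \<omega>)"
  have "?K \<subseteq> - \<omega>" by (rule closure_minimal) (use assms(2) in auto)
  then have "interior ?K \<inter> \<Omega> \<subseteq> interior (\<Omega> - \<omega>)"
    by (intro interior_maximal open_Int open_interior assms(1)) (use interior_subset in blast)
  moreover have "interior ?K \<subseteq> closure (interior ?K \<inter> \<Omega>)"
  proof -
    have "?K \<subseteq> closure \<Omega>" by (rule closure_mono) blast
    then have "interior ?K \<subseteq> interior ?K \<inter> closure \<Omega>" using interior_subset by blast
    also have "\<dots> \<subseteq> closure (interior ?K \<inter> \<Omega>)" by (rule open_Int_closure_subset) simp
    finally show ?thesis .
  qed
  ultimately have "interior ?K \<subseteq> closure (interior (\<Omega> - \<omega>))" using closure_mono by blast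
  then have "closure (interior ?K) \<subseteq> closure (interior (\<Omega> - \<omega>))" by (rule closure_minimal) simp
  then show ?thesis using assms(3) by simp
qed


section \<open>Admissible fields\<close>

text \<open>
  The Jacobian is bounded because it is continuous and, like \<open>X\<close>, vanishes off a compact set.
\<close>
lemma admissible_field_jacobian:
  fixes X :: "real^'n::finite \<Rightarrow> real^'n"
  assumes "admissible_field D \<omega> X" "bounded D"
  shows "(X has_derivative (\<lambda>h. jac X x *v h)) (at x)"
    and "continuous_on UNIV (jac X)" and "\<exists>B. \<forall>x. norm (jac X x) \<le> B"
    and "x \<in> \<omega> \<Longrightarrow> X x = 0"
proof -
  have diff: "X differentiable (at y)" and cont: "continuous_on UNIV (partial i X)" for y i
    using assms(1) by (auto simp: admissible_field_def)
  have supp: "closure {x. X x \<noteq> 0} \<subseteq> D - closure \<omega>"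
    using assms(1) by (auto simp: admissible_field_def)
  show der: "(X has_derivative (\<lambda>h. jac X x *v h)) (at x)" for x
    using diff jacobian_works by blast
  have "jac X = (\<lambda>x. \<chi> i j. partial j X x $ i)"
    by (rule ext) (simp add: jacobian_def matrix_def partial_def)
  then show cont': "continuous_on UNIV (jac X)"
    using cont by (simp only:) (intro continuous_on_vec_lambda continuous_on_component)
  have "compact (closure {x. X x \<noteq> 0})"
    using bounded_subset[OF assms(2), of "closure {x. X x \<noteq> 0}"] supp
    by (auto simp: compact_eq_bounded_closed)
  from compact_imp_bounded[OF compact_continuous_image[OF continuous_on_subset[OF cont' subset_UNIV] this]]
  obtain B where B: "B > 0" "\<And>x. x \<in> closure {x. X x \<noteq> 0} \<Longrightarrow> norm (jac X x) \<le> B"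
    by (auto simp: bounded_pos)
  have "norm (jac X x) \<le> B" for x
  proof (cases "x \<in> closure {x. X x \<noteq> 0}")
    case False
    have "((\<lambda>_. 0) has_derivative (\<lambda>h. jac X x *v h)) (at x)"
      by (rule has_derivative_transform_within_open[OF der, of "- closure {x. X x \<noteq> 0}"])
        (use False closure_subset[of "{x. X x \<noteq> 0}"] in auto)
    then have "(\<lambda>h. jac X x *v h) = (\<lambda>h. 0)"
      using has_derivative_unique[OF _ has_derivative_const] by blast
    then have "jac X x = 0" by (simp add: matrix_eq fun_eq_iff)
    then show ?thesis using B(1) by simp
  qed (rule B(2))
  then show "\<exists>B. \<forall>x. norm (jac X x) \<le> B" by blast
  show "X x = 0" if "x \<in> \<omega>"
    using supp that closure_subset[of \<omega>] closure_subset[of "{x. X x \<noteq> 0}"] by blast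
qed

text \<open>
  Whatever holds for all small \<open>Y\<close> and \<open>t\<close> holds in particular for \<open>Y = 0\<close>: the zero field is
  admissible and has \<open>C\<^sup>1\<close> norm zero, so it lies in every member of the filter of fields tending to
  zero.
\<close>
lemma filterlim_zero_field:
  assumes "open D" "D \<noteq> {}"
  shows "filterlim (\<lambda>t. (\<lambda>_. 0, t)) (fields_to_zero D \<omega> \<times>\<^sub>F L) L"
proof (rule filterlim_Pair[OF _ filterlim_ident])
  have "admissible_field D \<omega> (\<lambda>_. 0)"
  proof -
    have "partial i (\<lambda>_. 0 :: real^'a) = (\<lambda>_. 0)" for i :: 'a
      by (rule ext) (simp add: partial_def frechet_derivative_const)
    then show ?thesis by (simp add: admissible_field_def)
  qed
  then show "filterlim (\<lambda>t. (\<lambda>_. 0)) (fields_to_zero D \<omega>) L"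
    unfolding fields_to_zero_def
    by (simp add: filterlim_inf filterlim_filtercomap_iff filterlim_principal comp_def C1_norm_zero[OF assms])
qed


section \<open>The shape derivative\<close>

theorem theorem3p6:
  fixes D \<Gamma> \<Omega> \<omega> K A :: "(real^'n::finite) set"
    and f g X u udot :: "real^'n \<Rightarrow> real^'n"
    and du dudot :: "real^'n \<Rightarrow> real^'n^'n"
    and \<delta> lam mu :: real
    and J :: "(real^'n) set \<Rightarrow> real"
    and vM f_X :: "real^'n \<Rightarrow> real"
  assumes D: "bounded D" "connected D" "D \<noteq> {}" "lipschitz_set D"
    and \<Gamma>: "smooth_lipschitz_hypersurface \<Gamma>" "\<Gamma> \<subseteq> D"
    and \<Omega>: "lipschitz_set \<Omega>" "\<Omega> \<subseteq> D" "\<Gamma> \<subseteq> frontier \<Omega>"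
    and \<omega>: "open \<omega>" "\<omega> \<subseteq> D" "\<Gamma> \<subseteq> \<omega>"
    and K: "K = closure (\<Omega> - \<omega>)" "K \<noteq> {}" "K = closure (interior K)"
    and data: "H1 D f" "H2 D g" "\<delta> > 0" "lam > 0" "mu > 0"
    and solvable: "\<And>Z. admissible_field D \<omega> Z \<Longrightarrow> uniquely_solvable lam mu D \<omega> f g \<Gamma> \<Omega> Z"
    and regular: "\<And>Z. admissible_field D \<omega> Z \<Longrightarrow> C1_regular lam mu D \<omega> f g \<Gamma> \<Omega> Z"
    and X: "admissible_field D \<omega> X"
    and J: "J = J_sigma lam mu f g \<Gamma> \<omega> \<delta>"
    and u: "u = state lam mu f g \<Gamma> \<Omega>"
    and udot: "udot = material_derivative lam mu D f g \<Gamma> \<Omega> X"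
    and du: "du = C1_jac (\<Omega> - \<omega>) u"
    and dudot: "dudot = C1_jac (\<Omega> - \<omega>) udot"
    and vM: "vM = (\<lambda>x. von_mises_sq lam mu (du x))"
    and A: "A = {z \<in> K. vM z = max_over vM K}"
    and f_X: "f_X = (\<lambda>x. 2 * (tensor_B lam mu (sym_part (du x)) \<bullet> sym_part (dudot x))
                - tensor_B lam mu (du x ** jac X x + transpose (jac X x) ** transpose (du x))
                    \<bullet> sym_part (du x))"
  shows "((\<lambda>t. (J (transformation (\<lambda>_. 0) X t ` \<Omega>) - J \<Omega>) / t) \<longlongrightarrow>
           (if \<forall>z\<in>A. vM z > \<delta> then max_over f_X A
            else if \<forall>z\<in>A. vM z = \<delta> then max (max_over f_X A) 0
            else 0)) (at_right 0)"
proof -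
  let ?S = "\<Omega> - \<omega>"
  define DX where "DX = jac X"
  define F where "F = transformation (\<lambda>_. 0) X"
  define w where "w = pullback_state lam mu f g \<Gamma> \<Omega> X (\<lambda>_. 0)"
  define G where "G t = C1_jac ?S (w t)" for t
  define P where "P t x = matrix_inv (mat 1 + t *\<^sub>R DX x)" for t x
  define h where "h t x = von_mises_sq lam mu (G t x ** P t x)" for t x
  interpret mm: bounded_bilinear "(**) :: real^'n^'n \<Rightarrow> real^'n^'n \<Rightarrow> real^'n^'n"
    by (rule bounded_bilinear_matrix_matrix_mult)
  interpret vm: bounded_bilinear "von_mises_form lam mu :: real^'n^'n \<Rightarrow> real^'n^'n \<Rightarrow> real"
    by (rule bounded_bilinear_von_mises_form)
  have op: "open D" "open \<Omega>" using D(4) \<Omega>(1) by (auto simp: lipschitz_set_def)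
  have S: "?S \<in> sets lebesgue" using op \<omega>(1) by (intro sets.Diff) auto
  have dense: "closure ?S \<subseteq> closure (interior ?S)"
    using closure_diff_subset_closure_interior[OF op(2) \<omega>(1)] K by simp
  have cptK: "compact K"
    unfolding K(1) compact_closure using bounded_subset[OF D(1)] \<Omega>(2) by blast
  note cpt = cptK[unfolded K(1)]
  obtain B where B: "\<And>x. norm (DX x) \<le> B"
    using admissible_field_jacobian(3)[OF X D(1)] by (auto simp: DX_def)
  have derX: "(X has_derivative (\<lambda>h. DX x *v h)) (at x)" for x
    using admissible_field_jacobian(1)[OF X D(1)] by (simp add: DX_def)
  have contDX: "continuous_on T DX" for T
    using admissible_field_jacobian(2)[OF X D(1)] continuous_on_subset by (auto simp: DX_def)
  note bounded_image = compact_imp_bounded[OF compact_continuous_image[OF _ cptK]]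

  \<comment> \<open>The regularity assumption is evaluated along \<open>Y = 0\<close>, where the pulled back state \<open>w 0\<close> is
      \<open>u\<close> itself.\<close>
  note to0 = filterlim_zero_field[OF op(1) D(3), of \<omega>]
  have w0: "w 0 = u"
    by (simp add: w_def pullback_state_def u transformation_def comp_def)
  have w: "w t = state lam mu f g \<Gamma> (F t ` \<Omega>) \<circ> F t" for t
    by (simp add: w_def pullback_state_def F_def)
  note reg = regular[OF X, unfolded C1_regular_def Let_def, folded u udot]
  have "\<forall>\<^sub>F t in inf (nhds 0) (principal {0..}). in_C1 ?S (w t)"
    using filterlim_iff[THEN iffD1, OF to0, rule_format, OF conjunct1[OF reg]]
    by (simp add: w_def)
  then have w_C1: "in_C1 ?S (w 0)" "\<forall>\<^sub>F t in at_right 0. in_C1 ?S (w t)"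
    unfolding eventually_inf_principal eventually_at_filter
    using eventually_nhds_x_imp_x by (force, auto elim: eventually_mono)
  have udot_C1: "in_C1 ?S udot" using reg by blast
  have norm_lim: "((\<lambda>t. C1_norm ?S (\<lambda>x. (w t x - w 0 x) /\<^sub>R t - udot x)) \<longlongrightarrow> 0) (at_right 0)"
    using filterlim_compose[OF conjunct2[OF conjunct2[OF conjunct2[OF reg]]] to0]
    by (simp add: w_def)
  obtain V0 where V0: "C1_rep ?S (w 0) V0 (G 0)"
    using C1_rep_C1_jac[OF S dense w_C1(1)] by (auto simp: G_def)
  obtain V1 where V1: "C1_rep ?S udot V1 dudot"
    using C1_rep_C1_jac[OF S dense udot_C1] by (auto simp: dudot)
  have G0: "G 0 = du" by (simp add: G_def w0 du)
  have cont: "continuous_on K du" "continuous_on K dudot"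
    using V0 V1 by (auto simp: C1_rep_def G0 K(1))
  have contG: "\<forall>\<^sub>F t in at_right 0. continuous_on K (G t)"
    using w_C1(2)
    by eventually_elim (use C1_rep_C1_jac[OF S dense] in \<open>auto simp: C1_rep_def G_def K(1)\<close>)
  have Glim: "uniform_limit K (\<lambda>t x. (G t x - du x) /\<^sub>R t) dudot (at_right 0)"
  proof (rule uniform_limitI)
    fix e :: real assume "e > 0"
    from tendstoD[OF norm_lim this] w_C1(2)
    show "\<forall>\<^sub>F t in at_right 0. \<forall>x\<in>K. dist ((G t x - du x) /\<^sub>R t) (dudot x) < e"
    proof eventually_elim
      case (elim t)
      obtain V where "C1_rep ?S (w t) V (G t)"
        using C1_rep_C1_jac[OF S dense elim(2)] by (auto simp: G_def)
      note rep = C1_rep_diff[OF C1_rep_scaleR[OF C1_rep_diff[OF this V0], of "inverse t"] V1]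
      show ?case
      proof
        fix x assume "x \<in> K"
        from norm_le_C1_norm[OF S dense cpt rep this[unfolded K(1)]] elim(1)
        show "dist ((G t x - du x) /\<^sub>R t) (dudot x) < e" by (simp add: dist_norm G0)
      qed
    qed
  qed

  \<comment> \<open>The Jacobian of the state on the moved domain, seen from \<open>K\<close>, is \<open>G t x ** P t x\<close>.\<close>
  have pert: "\<forall>\<^sub>F t in at_right 0. inj (F t) \<and>
      (\<forall>x. (mat 1 + t *\<^sub>R DX x) ** P t x = mat 1 \<and> norm (P t x) \<le> 2 * norm (mat 1 :: real^'n^'n))"
    using small_perturbation_of_identity[OF derX B]
    by (simp add: F_def transformation_def[abs_def] P_def)
  have contP: "continuous_on UNIV (P t)"
    if "\<forall>x. (mat 1 + t *\<^sub>R DX x) ** P t x = mat 1 \<and> norm (P t x) \<le> 2 * norm (mat 1 :: real^'n^'n)" for t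
    by (rule continuous_on_right_inverse_matrix[of _ "\<lambda>x. mat 1 + t *\<^sub>R DX x"])
      (use that contDX in \<open>auto intro!: continuous_intros\<close>)
  have "uniform_limit K (\<lambda>t x. (G t x ** P t x - du x) /\<^sub>R t)
      (\<lambda>x. dudot x - du x ** DX x) (at_right 0)"
    by (rule uniform_limit_inverse_perturbation[OF Glim, where B="2 * norm (mat 1 :: real^'n^'n)"])
      (use pert in \<open>auto intro!: bounded_image cont contDX elim: eventually_mono\<close>)
  from quadratic_difference_quotient[OF vm.bounded_bilinear_axioms von_mises_form_commute this
      bounded_image[OF continuous_on_diff[OF cont(2) mm.continuous_on[OF cont(1) contDX]]]
      bounded_image[OF cont(1)]]
  have "uniform_limit K (\<lambda>t x. (h t x - vM x) / t)
      (\<lambda>x. 2 * von_mises_form lam mu (du x) (dudot x - du x ** DX x)) (at_right 0)"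
    by (simp add: h_def vM von_mises_sq_eq_form)
  moreover have fX: "f_X = (\<lambda>x. 2 * von_mises_form lam mu (du x) (dudot x - du x ** DX x))"
  proof
    fix x
    have "2 * von_mises_form lam mu (du x) (du x ** DX x)
        = tensor_B lam mu (du x ** jac X x + transpose (jac X x) ** transpose (du x)) \<bullet> sym_part (du x)"
      unfolding von_mises_form_commute[of lam mu "du x"] von_mises_form_eq_tensor_B
      by (simp add: matrix_transpose_mul DX_def)
    then show "f_X x = 2 * von_mises_form lam mu (du x) (dudot x - du x ** DX x)"
      unfolding f_X vm.diff_right right_diff_distrib by (simp add: von_mises_form_def)
  qed
  ultimately have hlim: "uniform_limit K (\<lambda>t x. (h t x - vM x) / t) f_X (at_right 0)" by simp
  have contf: "continuous_on K f_X"
    unfolding fX by (intro continuous_intros vm.continuous_on mm.continuous_on cont contDX)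
  have contv: "continuous_on K vM"
    unfolding vM von_mises_sq_eq_form by (intro vm.continuous_on cont)
  have conth: "\<forall>\<^sub>F t in at_right 0. continuous_on K (h t)"
    using contG pert
    by eventually_elim
      (unfold h_def von_mises_sq_eq_form,
        intro vm.continuous_on mm.continuous_on, auto intro: continuous_on_subset[OF contP])
  note danskin = danskin_directional_derivative[OF cptK K(2) contv contf conth hlim, folded A]
  from positive_part_directional_derivative[OF this, of \<delta>]
  have lim: "((\<lambda>t. (max (max_over (h t) K - \<delta>) 0 - max (max_over vM K - \<delta>) 0) / t) \<longlongrightarrow>
      (if max_over vM K > \<delta> then max_over f_X A
       else if max_over vM K = \<delta> then max (max_over f_X A) 0 else 0)) (at_right 0)" .

  have "A \<noteq> {}" using max_over_attained(1)[OF cptK K(2) contv] by (auto simp: A)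
  then have cases: "(\<forall>z\<in>A. vM z > \<delta>) \<longleftrightarrow> max_over vM K > \<delta>" "(\<forall>z\<in>A. vM z = \<delta>) \<longleftrightarrow> max_over vM K = \<delta>"
    by (auto simp: A)
  have J0: "J \<Omega> = max (max_over vM K - \<delta>) 0"
    by (simp add: J J_sigma_def vM du u K(1))
  have "\<forall>\<^sub>F t in at_right 0. J (F t ` \<Omega>) = max (max_over (h t) K - \<delta>) 0"
    using pert w_C1(2)
  proof eventually_elim
    case (elim t)
    have F: "inj (F t)" "(F t has_derivative (\<lambda>h. (mat 1 + t *\<^sub>R DX x) *v h)) (at x)" for x
    proof -
      have "((\<lambda>x. x + 0 + t *\<^sub>R X x) has_derivative (\<lambda>h. h + 0 + t *\<^sub>R (DX x *v h))) (at x)"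
        by (intro has_derivative_add has_derivative_ident has_derivative_const
            has_derivative_scaleR_right derX)
      then show "(F t has_derivative (\<lambda>h. (mat 1 + t *\<^sub>R DX x) *v h)) (at x)"
        by (simp add: F_def transformation_def[abs_def] matrix_vector_mult_add_rdistrib
            scaleR_matrix_vector_assoc)
    qed (use elim(1) in blast)
    have "F t x = x" if "x \<in> \<omega>" for x
      using admissible_field_jacobian(4)[OF X D(1) that] by (simp add: F_def transformation_def)
    \<comment> \<open>Thus \<open>F t\<close> maps \<open>\<omega>\<close> onto itself, and by injectivity nothing else into it.\<close>
    then have "F t ` \<omega> = \<omega>" by simp
    with image_set_diff[OF F(1), of \<Omega> \<omega>] have img: "F t ` \<Omega> - \<omega> = F t ` ?S" by simp
    have "continuous_on \<Omega> (F t)"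
      using F(2) by (meson has_derivative_continuous continuous_at_imp_continuous_on)
    then have "open (F t ` \<Omega>)"
      by (rule invariance_of_domain[OF _ op(2)]) (use F(1) in \<open>auto intro: inj_on_subset\<close>)
    then have FS: "F t ` ?S \<in> sets lebesgue"
      unfolding img[symmetric] using \<omega>(1) by (intro sets.Diff) auto
    obtain V where V: "C1_rep ?S (state lam mu f g \<Gamma> (F t ` \<Omega>) \<circ> F t) V (G t)"
      using C1_rep_C1_jac[OF S dense elim(2)] by (auto simp: G_def w)
    have P: "(mat 1 + t *\<^sub>R DX x) ** P t x = mat 1" for x using elim(1) by blast
    show ?case
      unfolding J J_sigma_def img h_def K(1)
        max_von_mises_sq_image[OF F P contP[OF conjunct2[OF elim(1)]] S FS cpt dense V] ..
  qed
  then have "\<forall>\<^sub>F t in at_right 0. (max (max_over (h t) K - \<delta>) 0 - max (max_over vM K - \<delta>) 0) / t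
      = (J (transformation (\<lambda>_. 0) X t ` \<Omega>) - J \<Omega>) / t"
    by eventually_elim (simp add: J0 F_def)
  from Lim_transform_eventually[OF lim this] show ?thesis by (simp only: cases)
qed

end
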